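(* Let $\Omega_1\subset\mathbb{R}^{N_1}$ and $\Omega_2\subset\mathbb{R}^{N_2}$ be regions satisfying (B1), and let $\Omega_p:=\Omega_1\times\Omega_2$. Let $\{\lambda_{1j}\}_{j\in\mathbb{N}}$, $\{e_{1j}\}_{j\in\mathbb{N}}$ and $\{\lambda_{2k}\}_{k\in\mathbb{N}}$, $\{e_{2k}\}_{k\in\mathbb{N}}$ be the sequences of Dirichlet Laplacian eigenvalues and eigenfunctions on $\Omega_1$ and $\Omega_2$ respectively. Put $u_{jk}:=e_{1j}\otimes e_{2k}$, $\tilde u_{jk}:=(\lambda_{1j}+\lambda_{2k})^{-1/2}u_{jk}$, $\mathcal{U}:=\{u_{jk}:j,k\in\mathbb{N}\}$ and $\widetilde{\mathcal{U}}:=\{\tilde u_{jk}:j,k\in\mathbb{N}\}$. Then $\mathcal{U}$ is an orthonormal basis of $L^2(\Omega_p)$ and $\widetilde{\mathcal{U}}$ is an orthonormal basis of $H_0^1(\Omega_p)$ with respect to the inner product $[u,v]_\nabla:=\int_{\Omega_p}\nabla u\cdot\nabla v\,dx\,dy$.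
   Context: A region is a nonempty, connected, open subset of $\mathbb{R}^N$. Condition (B1) on a region $\Omega\subset\mathbb{R}^N$: $\Omega$ is bounded and its boundary $\partial\Omega:=\overline{\Omega}\setminus\Omega$ is the union of a finite number of disjoint closed Lipschitz surfaces, each having finite surface area. All function spaces are real. The Dirichlet Laplacian eigenproblem on a region $\Omega$ is to find $(\lambda,u)\in\mathbb{R}\times H_0^1(\Omega)$ with $u\neq 0$ such that $\int_\Omega\nabla u\cdot\nabla h\,dx=\lambda\int_\Omega u\,h\,dx$ for all $h\in H_0^1(\Omega)$. The sequences of Dirichlet eigendata on $\Omega$ are $\{\lambda_j:j\in\mathbb{N}\}$, the strictly positive eigenvalues repeated according to multiplicity with $\lambda_j\to\infty$, and an associated sequence of eigenfunctions $\{e_j:j\in\mathbb{N}\}$ forming an orthonormal basis of $L^2(\Omega)$, such that $\{\lambda_j^{-1/2}e_j\}$ is an orthonormal basis of $H_0^1(\Omega)$ with respect to the inner product $[u,v]_\nabla:=\int_\Omega\nabla u\cdot\nabla v\,dx$. For functions $e$ on $\Omega_1$ and $f$ on $\Omega_2$, $(e\otimes f)(x,y):=e(x)f(y)$ for $(x,y)\in\Omega_1\times\Omega_2$. *)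

theory Defs
  imports "HOL-Analysis.Analysis"
begin

section \<open>Regions and condition (B1)\<close>

definition region :: "'a::euclidean_space set \<Rightarrow> bool" where
  "region \<Omega> \<longleftrightarrow> open \<Omega> \<and> connected \<Omega> \<and> \<Omega> \<noteq> {}"

text \<open>
  Normalised \<open>d\<close>-dimensional Hausdorff measure. The empty set is singled out because
  \<open>0 ^ 0 = 1\<close>, and boundedness is required because \<open>diameter\<close> is unspecified on unbounded sets.
\<close>

definition hausdorff_premeasure :: "nat \<Rightarrow> real \<Rightarrow> 'a::metric_space set \<Rightarrow> ennreal" where
  "hausdorff_premeasure d \<delta> A =
     (INF C \<in> {C :: nat \<Rightarrow> 'a set. A \<subseteq> (\<Union>i. C i) \<and> (\<forall>i. bounded (C i) \<and> diameter (C i) \<le> \<delta>)}.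
        \<Sum>i. if C i = {} then 0
            else ennreal (unit_ball_vol (real d) * (diameter (C i) / 2) ^ d))"

definition hausdorff_measure :: "nat \<Rightarrow> 'a::metric_space set \<Rightarrow> ennreal" where
  "hausdorff_measure d A = (SUP \<delta>\<in>{0<..}. hausdorff_premeasure d \<delta> A)"

definition surface_area :: "'a::euclidean_space set \<Rightarrow> ennreal" where
  "surface_area S = hausdorff_measure (DIM('a) - 1) S"

text \<open>
  A closed (compact, without boundary) connected hypersurface that near each of its points is the
  graph, in some direction \<open>n\<close>, of a Lipschitz function \<open>\<gamma>\<close> on the hyperplane orthogonal to \<open>n\<close>.
  In dimension one such a surface is a single point.
\<close>

definition closed_lipschitz_surface :: "'a::euclidean_space set \<Rightarrow> bool" where
  "closed_lipschitz_surface S \<longleftrightarrow>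
     compact S \<and> connected S \<and> S \<noteq> {} \<and>
     (\<forall>x\<in>S. \<exists>U n (\<gamma> :: 'a \<Rightarrow> real) L.
        open U \<and> x \<in> U \<and> norm n = 1 \<and> L-lipschitz_on {z. z \<bullet> n = 0} \<gamma> \<and>
        S \<inter> U = {y\<in>U. y \<bullet> n = \<gamma> (y - (y \<bullet> n) *\<^sub>R n)})"

definition B1 :: "'a::euclidean_space set \<Rightarrow> bool" where
  "B1 \<Omega> \<longleftrightarrow> bounded \<Omega> \<and>
     (\<exists>\<S>. finite \<S> \<and> pairwise disjnt \<S> \<and> \<Union>\<S> = closure \<Omega> - \<Omega> \<and>
        (\<forall>S\<in>\<S>. closed_lipschitz_surface S \<and> surface_area S < \<infinity>))"


section \<open>Function spaces\<close>

text \<open>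
  Elements of \<open>L\<^sup>2(\<Omega>)\<close>, \<open>H\<^sup>1(\<Omega>)\<close> and \<open>H\<^sub>0\<^sup>1(\<Omega>)\<close> are represented by functions on the whole space
  whose values outside \<open>\<Omega>\<close> are irrelevant; the spaces of the literature are the quotients by
  equality almost everywhere on \<open>\<Omega>\<close>.
\<close>

definition L2 :: "'a::euclidean_space set \<Rightarrow> ('a \<Rightarrow> 'b::euclidean_space) set" where
  "L2 \<Omega> = {f \<in> borel_measurable (lebesgue_on \<Omega>). integrable (lebesgue_on \<Omega>) (\<lambda>x. (norm (f x))\<^sup>2)}"

definition L2_inner :: "'a::euclidean_space set \<Rightarrow> ('a \<Rightarrow> real) \<Rightarrow> ('a \<Rightarrow> real) \<Rightarrow> real" where
  "L2_inner \<Omega> u v = (LINT x|lebesgue_on \<Omega>. u x * v x)"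

primrec Ck :: "nat \<Rightarrow> ('a::euclidean_space \<Rightarrow> real) \<Rightarrow> bool" where
  "Ck 0 f \<longleftrightarrow> continuous_on UNIV f"
| "Ck (Suc k) f \<longleftrightarrow>
     (\<forall>x. f differentiable at x) \<and> (\<forall>b\<in>Basis. Ck k (\<lambda>x. frechet_derivative f (at x) b))"

text \<open>\<open>C\<^sub>c\<^sup>\<infinity>(\<Omega>)\<close>, each function being extended by zero.\<close>

definition test_functions :: "'a::euclidean_space set \<Rightarrow> ('a \<Rightarrow> real) set" where
  "test_functions \<Omega> =
     {\<phi>. (\<forall>k. Ck k \<phi>) \<and> compact (closure {x. \<phi> x \<noteq> 0}) \<and> closure {x. \<phi> x \<noteq> 0} \<subseteq> \<Omega>}"

definition has_weak_gradient ::
    "'a::euclidean_space set \<Rightarrow> ('a \<Rightarrow> real) \<Rightarrow> ('a \<Rightarrow> 'a) \<Rightarrow> bool" where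
  "has_weak_gradient \<Omega> u g \<longleftrightarrow> g \<in> L2 \<Omega> \<and>
     (\<forall>\<phi>\<in>test_functions \<Omega>. \<forall>b\<in>Basis.
        (LINT x|lebesgue_on \<Omega>. u x * frechet_derivative \<phi> (at x) b) =
        - (LINT x|lebesgue_on \<Omega>. (g x \<bullet> b) * \<phi> x))"

definition H1 :: "'a::euclidean_space set \<Rightarrow> ('a \<Rightarrow> real) set" where
  "H1 \<Omega> = {u \<in> L2 \<Omega>. \<exists>g. has_weak_gradient \<Omega> u g}"

text \<open>The weak gradient is unique only almost everywhere on \<open>\<Omega>\<close>; a representative is chosen.\<close>

definition weak_grad :: "'a::euclidean_space set \<Rightarrow> ('a \<Rightarrow> real) \<Rightarrow> 'a \<Rightarrow> 'a" where
  "weak_grad \<Omega> u = (SOME g. has_weak_gradient \<Omega> u g)"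

definition grad_inner :: "'a::euclidean_space set \<Rightarrow> ('a \<Rightarrow> real) \<Rightarrow> ('a \<Rightarrow> real) \<Rightarrow> real" where
  "grad_inner \<Omega> u v = (LINT x|lebesgue_on \<Omega>. weak_grad \<Omega> u x \<bullet> weak_grad \<Omega> v x)"

definition H1_norm :: "'a::euclidean_space set \<Rightarrow> ('a \<Rightarrow> real) \<Rightarrow> real" where
  "H1_norm \<Omega> u = sqrt (L2_inner \<Omega> u u + grad_inner \<Omega> u u)"

text \<open>The closure of \<open>C\<^sub>c\<^sup>\<infinity>(\<Omega>)\<close> in \<open>H\<^sup>1(\<Omega>)\<close>.\<close>

definition H01 :: "'a::euclidean_space set \<Rightarrow> ('a \<Rightarrow> real) set" where
  "H01 \<Omega> = {u \<in> H1 \<Omega>. \<forall>\<epsilon>>0. \<exists>\<phi>\<in>test_functions \<Omega>. H1_norm \<Omega> (\<lambda>x. u x - \<phi> x) < \<epsilon>}"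

text \<open>
  The family \<open>e\<close> is orthonormal in \<open>V\<close> for the inner product \<open>ip\<close>, and its linear span is dense in
  \<open>V\<close> for the induced norm. Orthonormality of the family makes its members pairwise distinct.
\<close>

definition orthonormal_basis ::
    "('a \<Rightarrow> real) set \<Rightarrow> (('a \<Rightarrow> real) \<Rightarrow> ('a \<Rightarrow> real) \<Rightarrow> real) \<Rightarrow> ('i \<Rightarrow> 'a \<Rightarrow> real) \<Rightarrow> bool" where
  "orthonormal_basis V ip e \<longleftrightarrow>
     (\<forall>i. e i \<in> V) \<and>
     (\<forall>i j. ip (e i) (e j) = (if i = j then 1 else 0)) \<and>
     (\<forall>v\<in>V. \<forall>\<epsilon>>0. \<exists>F c. finite F \<and>
        (let r = (\<lambda>x. v x - (\<Sum>i\<in>F. c i * e i x)) in sqrt (ip r r) < \<epsilon>))"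


section \<open>Dirichlet eigendata\<close>

definition dirichlet_eigenpair :: "'a::euclidean_space set \<Rightarrow> real \<Rightarrow> ('a \<Rightarrow> real) \<Rightarrow> bool" where
  "dirichlet_eigenpair \<Omega> \<mu> u \<longleftrightarrow>
     u \<in> H01 \<Omega> \<and> \<not> (AE x in lebesgue_on \<Omega>. u x = 0) \<and>
     (\<forall>h\<in>H01 \<Omega>. grad_inner \<Omega> u h = \<mu> * L2_inner \<Omega> u h)"

text \<open>
  The third conjunct says that all eigenvalues occur, repeated according to multiplicity: the
  (finitely many, orthonormal) \<open>e j\<close> with \<open>lam j = \<mu>\<close> span the eigenspace of \<open>\<mu>\<close>.
\<close>

definition dirichlet_eigendata ::
    "'a::euclidean_space set \<Rightarrow> (nat \<Rightarrow> real) \<Rightarrow> (nat \<Rightarrow> 'a \<Rightarrow> real) \<Rightarrow> bool" where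
  "dirichlet_eigendata \<Omega> lam e \<longleftrightarrow>
     (\<forall>j. lam j > 0) \<and>
     (\<forall>j. dirichlet_eigenpair \<Omega> (lam j) (e j)) \<and>
     (\<forall>\<mu> u. dirichlet_eigenpair \<Omega> \<mu> u \<longrightarrow>
        (\<exists>c. AE x in lebesgue_on \<Omega>. u x = (\<Sum>j | lam j = \<mu>. c j * e j x))) \<and>
     filterlim lam at_top sequentially \<and>
     orthonormal_basis (L2 \<Omega>) (L2_inner \<Omega>) e \<and>
     orthonormal_basis (H01 \<Omega>) (grad_inner \<Omega>) (\<lambda>j x. lam j powr (- 1 / 2) * e j x)"

definition tensor :: "('a \<Rightarrow> real) \<Rightarrow> ('b \<Rightarrow> real) \<Rightarrow> 'a \<times> 'b \<Rightarrow> real" where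
  "tensor e f = (\<lambda>(x, y). e x * f y)"

end

theory Submission imports Defs begin

text \<open>
  Orthonormality of the tensors \<open>u\<^sub>j\<^sub>k = e\<^sub>1\<^sub>j \<otimes> e\<^sub>2\<^sub>k\<close> is Fubini's theorem: the \<open>L\<^sup>2\<close> product of two tensors is the
  product of the \<open>L\<^sup>2\<close> products of their factors, and since the weak gradient of \<open>e \<otimes> f\<close> is
  \<open>(f \<nabla>e, e \<nabla>f)\<close>, the gradient product of \<open>u\<^sub>j\<^sub>k\<close> with itself is the sum \<open>\<lambda>\<^sub>1\<^sub>j + \<lambda>\<^sub>2\<^sub>k\<close>. The substance is the
  density of the spans, and it is reduced to Parseval's identity on a dense set of functions
  (\<open>orthonormal_basisI\<close>).

  For \<open>L\<^sup>2\<close>, expand the slice \<open>v(\<cdot>, y)\<close> in the first basis. Its coefficients are functions of \<open>y\<close>, whose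
  coefficients in the second basis are those of \<open>v\<close> with respect to \<open>u\<^sub>j\<^sub>k\<close>. Applying Parseval's identity
  in each variable and integrating over \<open>y\<close> gives \<open>\<Sum> \<langle>v, u\<^sub>j\<^sub>k\<rangle>\<^sup>2 = \<parallel>v\<parallel>\<^sup>2\<close> (\<open>Parseval_by_slices\<close>).

  For \<open>H\<^sub>0\<^sup>1\<close>, it is enough to treat a test function \<open>\<Phi>\<close>. All its slices are test functions on the factors,
  so Parseval's identity in \<open>H\<^sub>0\<^sup>1(\<Omega>\<^sub>1)\<close> holds for every slice, and the same double expansion gives
  \<open>\<Sum> \<lambda>\<^sub>1\<^sub>j \<langle>\<Phi>, u\<^sub>j\<^sub>k\<rangle>\<^sup>2 = \<parallel>\<nabla>\<^sub>x \<Phi>\<parallel>\<^sup>2\<close>. Adding the analogous identity in the other variable yields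
  \<open>\<Sum> (\<lambda>\<^sub>1\<^sub>j + \<lambda>\<^sub>2\<^sub>k) \<langle>\<Phi>, u\<^sub>j\<^sub>k\<rangle>\<^sup>2 = \<parallel>\<nabla>\<Phi>\<parallel>\<^sup>2\<close> (\<open>dirichlet_Parseval_tensor\<close>). Because \<open>u\<^sub>j\<^sub>k\<close> satisfies the eigenvalue
  equation for \<open>\<lambda>\<^sub>1\<^sub>j + \<lambda>\<^sub>2\<^sub>k\<close> (\<open>grad_inner_tensor_test_function\<close>), this is Parseval's identity for the normalised
  tensors in the gradient product.

  Two facts support this. The tensors lie in \<open>H\<^sub>0\<^sup>1\<close>, because the \<open>H\<^sup>1\<close> norm of a tensor is at most the product of
  the \<open>H\<^sup>1\<close> norms and tensors of test functions are test functions (\<open>H01_tensor\<close>). And weak gradients are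
  unique almost everywhere, because test functions are dense in \<open>L\<^sup>2\<close>: on the factors this holds since
  the eigenfunctions are a basis of \<open>L\<^sup>2\<close> and limits of test functions, and on the product it then follows
  from the statement about \<open>L\<^sup>2\<close> (\<open>test_functions_denseI\<close>).
\<close>

section \<open>Fubini and Tonelli for Lebesgue measurable functions\<close>

text \<open>
  Lebesgue measure on a product is the completion of the product measure, not the product of the
  completions, so the slices of a Lebesgue measurable function are measurable only for almost every
  parameter. Everything is transferred from a Borel function that agrees almost everywhere.
\<close>

lemma lebesgue_on_borel_version:
  fixes f :: "'a::euclidean_space \<Rightarrow> real"
  assumes "open S" "f \<in> borel_measurable (lebesgue_on S)"
  obtains g where "g \<in> borel_measurable borel" "AE x in lebesgue. indicator S x * f x = g x"
proof -
  have "(\<lambda>x. indicator S x *\<^sub>R f x) \<in> borel_measurable lebesgue"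
    using assms by (subst borel_measurable_restrict_space_iff[symmetric]) auto
  from completion_ex_borel_measurable_real[of "\<lambda>x. indicator S x * f x" lborel] this
  obtain g where "g \<in> borel_measurable lborel" "AE x in lborel. indicator S x * f x = g x"
    by auto
  then show ?thesis
    by (intro that[of g]) (auto intro: AE_completion)
qed

lemma AE_lebesgue_on_iff:
  "open S \<Longrightarrow> (AE x in lebesgue_on S. P x) \<longleftrightarrow> (AE x in lebesgue. x \<in> S \<longrightarrow> P x)"
  by (subst AE_restrict_space_iff) auto

lemma AE_lebesgue_slices:
  fixes P :: "'a::euclidean_space \<times> 'b::euclidean_space \<Rightarrow> bool"
  assumes "AE z in lebesgue. P z"
  shows "AE x in lebesgue. AE y in lebesgue. P (x, y)"
proof -
  have "AE z in (lborel \<Otimes>\<^sub>M lborel :: ('a \<times> 'b) measure). P z"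
    using assms unfolding lborel_prod by (simp add: AE_completion_iff)
  from lborel_pair.AE_pair[OF this] show ?thesis
    by (simp add: AE_completion_iff)
qed

text \<open>
  Exchanging the factors preserves Lebesgue measure. This halves the work twice: iterated integrals
  in the second order reduce to those in the first, and Parseval's identity for the gradient in the
  second variable reduces to the one for the first.
\<close>
lemma swap_measurable_lebesgue_and_distr:
  "(prod.swap :: 'a::euclidean_space \<times> 'b::euclidean_space \<Rightarrow> _) \<in> lebesgue \<rightarrow>\<^sub>M lebesgue"
  "distr lebesgue lebesgue (prod.swap :: 'a \<times> 'b \<Rightarrow> _) = lebesgue"
proof -
  let ?s = "prod.swap :: 'a \<times> 'b \<Rightarrow> 'b \<times> 'a"
  have cont: "continuous_on UNIV ?s"
    unfolding prod.swap_def by (intro continuous_intros)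
  have meas_b: "?s \<in> borel \<rightarrow>\<^sub>M borel"
    by (rule borel_measurable_continuous_onI[OF cont])
  have meas: "?s \<in> lebesgue \<rightarrow>\<^sub>M lborel"
    using measurable_completion[of ?s lborel borel] meas_b by simp
  have "lborel = distr (lborel :: ('a \<times> 'b) measure) (lborel :: ('b \<times> 'a) measure) (\<lambda>(x, y). (y, x))"
    using lborel_pair.distr_pair_swap by (simp add: lborel_prod)
  moreover have "?s = (\<lambda>(x, y). (y, x))" by auto
  ultimately have d: "distr lborel lborel ?s = lborel" by metis
  have d': "distr lebesgue lborel ?s = lborel"
    using meas_b d by (subst distr_completion) auto
  show "?s \<in> lebesgue \<rightarrow>\<^sub>M lebesgue"
    by (rule completion.measurable_completion2[OF meas]) (simp add: d')
  show "distr lebesgue lebesgue ?s = lebesgue"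
    using completion.completion_distr_eq[OF meas] by (simp add: d')
qed

text \<open>
  The preimage of a null set under the projection is a null set times the whole space, hence null;
  this is what lifts Borel measurability to Lebesgue measurability.
\<close>
lemma fst_measurable_lebesgue:
  "(fst :: 'a::euclidean_space \<times> 'b::euclidean_space \<Rightarrow> 'a) \<in> lebesgue \<rightarrow>\<^sub>M lebesgue"
proof -
  have meas: "(fst :: 'a \<times> 'b \<Rightarrow> 'a) \<in> lebesgue \<rightarrow>\<^sub>M lborel"
    using measurable_completion[of "fst :: 'a \<times> 'b \<Rightarrow> 'a" lborel borel]
    by (simp add: borel_measurable_continuous_onI continuous_on_fst)
  show ?thesis
  proof (rule completion.measurable_completion2[OF meas], rule subsetI)
    fix N :: "'a set" assume N: "N \<in> null_sets lborel"
    have "emeasure lborel (N \<times> (UNIV :: 'b set)) = 0"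
      using N lborel.emeasure_pair_measure_Times[of N lborel "UNIV :: 'b set"]
      by (auto simp: lborel_prod null_sets_def)
    moreover have "(fst :: 'a \<times> 'b \<Rightarrow> 'a) -` N = N \<times> UNIV" by auto
    moreover have "N \<times> (UNIV :: 'b set) \<in> sets borel"
      using N by (auto intro!: borel_Times)
    ultimately show "N \<in> null_sets (distr lebesgue lborel (fst :: 'a \<times> 'b \<Rightarrow> 'a))"
      using N meas by (auto simp: null_sets_def emeasure_distr)
  qed
qed

lemma snd_measurable_lebesgue:
  "(snd :: 'a::euclidean_space \<times> 'b::euclidean_space \<Rightarrow> 'b) \<in> lebesgue \<rightarrow>\<^sub>M lebesgue"
proof -
  have "(snd :: 'a \<times> 'b \<Rightarrow> 'b) = fst \<circ> prod.swap" by auto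
  then show ?thesis
    using measurable_comp[OF swap_measurable_lebesgue_and_distr(1) fst_measurable_lebesgue] by metis
qed

lemma measurable_lebesgue_on_compose_fst:
  fixes f :: "'a::euclidean_space \<Rightarrow> 'c::euclidean_space" and T :: "'b::euclidean_space set"
  assumes "open S" "open T" "f \<in> borel_measurable (lebesgue_on S)"
  shows "(\<lambda>z. f (fst z)) \<in> borel_measurable (lebesgue_on (S \<times> T))"
proof (rule measurable_compose[OF _ assms(3)])
  show "(fst :: 'a \<times> 'b \<Rightarrow> 'a) \<in> lebesgue_on (S \<times> T) \<rightarrow>\<^sub>M lebesgue_on S"
    by (intro measurable_restrict_space2 measurable_restrict_space1 fst_measurable_lebesgue) auto
qed

lemma measurable_lebesgue_on_compose_snd:
  fixes f :: "'b::euclidean_space \<Rightarrow> 'c::euclidean_space" and S :: "'a::euclidean_space set"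
  assumes "open S" "open T" "f \<in> borel_measurable (lebesgue_on T)"
  shows "(\<lambda>z. f (snd z)) \<in> borel_measurable (lebesgue_on (S \<times> T))"
proof (rule measurable_compose[OF _ assms(3)])
  show "(snd :: 'a \<times> 'b \<Rightarrow> 'b) \<in> lebesgue_on (S \<times> T) \<rightarrow>\<^sub>M lebesgue_on T"
    by (intro measurable_restrict_space2 measurable_restrict_space1 snd_measurable_lebesgue) auto
qed

lemma swap_measurable_lebesgue_on:
  "prod.swap \<in> lebesgue_on (S \<times> T :: ('a::euclidean_space \<times> 'b::euclidean_space) set) \<rightarrow>\<^sub>M lebesgue_on (T \<times> S)"
  by (intro measurable_restrict_space2 measurable_restrict_space1
      swap_measurable_lebesgue_and_distr) auto

lemma nn_integral_lebesgue_on_swap: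
  fixes f :: "'b::euclidean_space \<times> 'a::euclidean_space \<Rightarrow> ennreal"
  assumes "open S" "open T" "f \<in> borel_measurable (lebesgue_on (T \<times> S))"
  shows "(\<integral>\<^sup>+z. f (prod.swap z) \<partial>lebesgue_on (S \<times> T)) = (\<integral>\<^sup>+z. f z \<partial>lebesgue_on (T \<times> S))"
proof -
  let ?g = "\<lambda>z. f z * indicator (T \<times> S) z"
  have o: "open (S \<times> T)" "open (T \<times> S)" using assms by (auto intro: open_Times)
  have g: "?g \<in> borel_measurable lebesgue"
    using assms o by (subst borel_measurable_restrict_space_iff_ennreal[symmetric]) auto
  have "(\<integral>\<^sup>+z. f z \<partial>lebesgue_on (T \<times> S)) = (\<integral>\<^sup>+z. ?g z \<partial>lebesgue)"
    using o by (subst nn_integral_restrict_space) auto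
  also have "\<dots> = (\<integral>\<^sup>+z. ?g z \<partial>distr lebesgue lebesgue prod.swap)"
    by (simp add: swap_measurable_lebesgue_and_distr(2))
  also have "\<dots> = (\<integral>\<^sup>+z. ?g (prod.swap z) \<partial>lebesgue)"
    by (rule nn_integral_distr[OF swap_measurable_lebesgue_and_distr(1)]) (use g in simp)
  also have "\<dots> = (\<integral>\<^sup>+z. f (prod.swap z) * indicator (S \<times> T) z \<partial>lebesgue)"
    by (intro nn_integral_cong) (auto simp: indicator_def prod_eq_iff mem_Times_iff)
  also have "\<dots> = (\<integral>\<^sup>+z. f (prod.swap z) \<partial>lebesgue_on (S \<times> T))"
    using o by (subst nn_integral_restrict_space) auto
  finally show ?thesis by simp
qed

lemma lebesgue_on_swap:
  fixes f :: "'b::euclidean_space \<times> 'a::euclidean_space \<Rightarrow> real"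
  assumes "open S" "open T" "f \<in> borel_measurable (lebesgue_on (T \<times> S))"
  shows "integrable (lebesgue_on (S \<times> T)) (\<lambda>z. f (prod.swap z)) \<longleftrightarrow> integrable (lebesgue_on (T \<times> S)) f"
    and "(LINT z|lebesgue_on (S \<times> T). f (prod.swap z)) = (LINT z|lebesgue_on (T \<times> S). f z)"
proof -
  let ?g = "\<lambda>z. indicator (T \<times> S) z *\<^sub>R f z"
  have o: "open (S \<times> T)" "open (T \<times> S)" using assms by (auto intro: open_Times)
  have g: "?g \<in> borel_measurable lebesgue"
    using assms o by (subst borel_measurable_restrict_space_iff[symmetric]) auto
  have eq: "?g (prod.swap z) = indicator (S \<times> T) z *\<^sub>R f (prod.swap z)" for z
    by (auto simp: indicator_def mem_Times_iff)
  have "integrable (lebesgue_on (T \<times> S)) f \<longleftrightarrow> integrable (distr lebesgue lebesgue prod.swap) ?g"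
    using o by (subst integrable_restrict_space) (auto simp: swap_measurable_lebesgue_and_distr(2))
  also have "\<dots> \<longleftrightarrow> integrable lebesgue (\<lambda>z. ?g (prod.swap z))"
    by (rule integrable_distr_eq[OF swap_measurable_lebesgue_and_distr(1) g])
  also have "\<dots> \<longleftrightarrow> integrable (lebesgue_on (S \<times> T)) (\<lambda>z. f (prod.swap z))"
    unfolding eq using o by (subst integrable_restrict_space) auto
  finally show "integrable (lebesgue_on (S \<times> T)) (\<lambda>z. f (prod.swap z)) \<longleftrightarrow> integrable (lebesgue_on (T \<times> S)) f"
    by simp
  have "(LINT z|lebesgue_on (T \<times> S). f z) = (LINT z|distr lebesgue lebesgue prod.swap. ?g z)"
    using o by (subst integral_restrict_space) (auto simp: swap_measurable_lebesgue_and_distr(2))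
  also have "\<dots> = (LINT z|lebesgue. ?g (prod.swap z))"
    by (rule integral_distr[OF swap_measurable_lebesgue_and_distr(1) g])
  also have "\<dots> = (LINT z|lebesgue_on (S \<times> T). f (prod.swap z))"
    unfolding eq using o by (subst integral_restrict_space) auto
  finally show "(LINT z|lebesgue_on (S \<times> T). f (prod.swap z)) = (LINT z|lebesgue_on (T \<times> S). f z)"
    by simp
qed

lemma lebesgue_on_borel_version_slices:
  fixes f :: "'a::euclidean_space \<times> 'b::euclidean_space \<Rightarrow> real"
  assumes S: "open S" and T: "open T" and f: "f \<in> borel_measurable (lebesgue_on (S \<times> T))"
  obtains g where "g \<in> borel_measurable (lborel \<Otimes>\<^sub>M lborel)"
    "AE z in lebesgue. indicator (S \<times> T) z * f z = g z"
    "AE x in lebesgue. AE y in lebesgue. indicator (S \<times> T) (x, y) * f (x, y) = g (x, y)"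
proof -
  have o: "open (S \<times> T)" using assms by (auto intro: open_Times)
  obtain g where g: "g \<in> borel_measurable borel" "AE z in lebesgue. indicator (S \<times> T) z * f z = g z"
    using lebesgue_on_borel_version[OF o f] by blast
  show ?thesis
    using that[of g] g AE_lebesgue_slices[OF g(2)] by (simp add: lborel_prod)
qed

lemma Tonelli_lebesgue_on:
  fixes f :: "'a::euclidean_space \<times> 'b::euclidean_space \<Rightarrow> real"
  assumes S: "open S" and T: "open T" and f: "f \<in> borel_measurable (lebesgue_on (S \<times> T))"
  shows "AE x in lebesgue_on S. (\<lambda>y. f (x, y)) \<in> borel_measurable (lebesgue_on T)"
    and "(\<integral>\<^sup>+z. ennreal (f z) \<partial>lebesgue_on (S \<times> T)) =
         (\<integral>\<^sup>+x. (\<integral>\<^sup>+y. ennreal (f (x, y)) \<partial>lebesgue_on T) \<partial>lebesgue_on S)"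
proof -
  have o: "open (S \<times> T)" using assms by (auto intro: open_Times)
  obtain g where g: "g \<in> borel_measurable (lborel \<Otimes>\<^sub>M lborel)"
    "AE z in lebesgue. indicator (S \<times> T) z * f z = g z"
    "AE x in lebesgue. AE y in lebesgue. indicator (S \<times> T) (x, y) * f (x, y) = g (x, y)"
    using lebesgue_on_borel_version_slices[OF assms] by blast
  have gx: "(\<lambda>y. g (x, y)) \<in> borel_measurable borel" for x
    using measurable_compose_Pair1[OF _ g(1), of x] by simp
  show "AE x in lebesgue_on S. (\<lambda>y. f (x, y)) \<in> borel_measurable (lebesgue_on T)"
    unfolding AE_lebesgue_on_iff[OF S] using g(3)
  proof eventually_elim
    case (elim x)
    show ?case
    proof
      assume x: "x \<in> S"
      have "AE y in lebesgue. g (x, y) = indicator T y *\<^sub>R f (x, y)"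
        using elim by eventually_elim (use x in \<open>auto simp: indicator_def split: if_splits\<close>)
      then have "(\<lambda>y. indicator T y *\<^sub>R f (x, y)) \<in> borel_measurable lebesgue"
        by (rule borel_measurable_AE[rotated]) (use gx[of x] in \<open>auto intro: measurable_completion\<close>)
      then show "(\<lambda>y. f (x, y)) \<in> borel_measurable (lebesgue_on T)"
        using T by (subst borel_measurable_restrict_space_iff) auto
    qed
  qed
  have "(\<integral>\<^sup>+z. ennreal (f z) \<partial>lebesgue_on (S \<times> T)) = (\<integral>\<^sup>+z. ennreal (f z) * indicator (S \<times> T) z \<partial>lebesgue)"
    using o by (subst nn_integral_restrict_space) auto
  also have "\<dots> = (\<integral>\<^sup>+z. ennreal (g z) \<partial>lebesgue)"
    by (rule nn_integral_cong_AE, use g(2) in eventually_elim) (force simp: indicator_def)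
  also have "\<dots> = (\<integral>\<^sup>+z. ennreal (g z) \<partial>(lborel \<Otimes>\<^sub>M lborel))"
    by (simp add: nn_integral_completion lborel_prod)
  also have "\<dots> = (\<integral>\<^sup>+x. (\<integral>\<^sup>+y. ennreal (g (x, y)) \<partial>lborel) \<partial>lborel)"
    using g(1) by (subst lborel.nn_integral_fst) auto
  also have "\<dots> = (\<integral>\<^sup>+x. (\<integral>\<^sup>+y. ennreal (g (x, y)) \<partial>lebesgue) \<partial>lebesgue)"
    by (simp add: nn_integral_completion)
  also have "\<dots> = (\<integral>\<^sup>+x. (\<integral>\<^sup>+y. ennreal (f (x, y)) \<partial>lebesgue_on T) * indicator S x \<partial>lebesgue)"
  proof (rule nn_integral_cong_AE, use g(3) in eventually_elim)
    case (elim x)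
    have "(\<integral>\<^sup>+y. ennreal (g (x, y)) \<partial>lebesgue) =
        (\<integral>\<^sup>+y. ennreal (f (x, y)) * indicator T y * indicator S x \<partial>lebesgue)"
      by (rule nn_integral_cong_AE, use elim in eventually_elim) (auto simp: indicator_def)
    also have "\<dots> = (\<integral>\<^sup>+y. ennreal (f (x, y)) \<partial>lebesgue_on T) * indicator S x"
      using T by (cases "x \<in> S") (auto simp: nn_integral_restrict_space)
    finally show ?case .
  qed
  also have "\<dots> = (\<integral>\<^sup>+x. (\<integral>\<^sup>+y. ennreal (f (x, y)) \<partial>lebesgue_on T) \<partial>lebesgue_on S)"
    using S by (simp add: nn_integral_restrict_space)
  finally show "(\<integral>\<^sup>+z. ennreal (f z) \<partial>lebesgue_on (S \<times> T)) =
         (\<integral>\<^sup>+x. (\<integral>\<^sup>+y. ennreal (f (x, y)) \<partial>lebesgue_on T) \<partial>lebesgue_on S)" .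
qed

lemma Fubini_lebesgue_on:
  fixes f :: "'a::euclidean_space \<times> 'b::euclidean_space \<Rightarrow> real"
  assumes S: "open S" and T: "open T" and f: "integrable (lebesgue_on (S \<times> T)) f"
  shows "AE x in lebesgue_on S. integrable (lebesgue_on T) (\<lambda>y. f (x, y))"
    and "integrable (lebesgue_on S) (\<lambda>x. LINT y|lebesgue_on T. f (x, y))"
    and "(LINT z|lebesgue_on (S \<times> T). f z) = (LINT x|lebesgue_on S. LINT y|lebesgue_on T. f (x, y))"
proof -
  have o: "open (S \<times> T)" using assms by (auto intro: open_Times)
  have fm: "f \<in> borel_measurable (lebesgue_on (S \<times> T))" using f by auto
  obtain g where g: "g \<in> borel_measurable (lborel \<Otimes>\<^sub>M lborel)"
    "AE z in lebesgue. indicator (S \<times> T) z * f z = g z"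
    "AE x in lebesgue. AE y in lebesgue. indicator (S \<times> T) (x, y) * f (x, y) = g (x, y)"
    using lebesgue_on_borel_version_slices[OF S T fm] by blast
  have gx: "(\<lambda>y. g (x, y)) \<in> borel_measurable borel" for x
    using measurable_compose_Pair1[OF _ g(1), of x] by simp
  have gb: "g \<in> borel_measurable lborel" using g(1) by (simp add: lborel_prod)
  have fi: "integrable lebesgue (\<lambda>z. indicator (S \<times> T) z *\<^sub>R f z)"
    using f o by (simp add: integrable_restrict_space)
  have "integrable lebesgue g"
    by (rule iffD1[OF integrable_cong_AE fi])
       (use g(2) gb fi in \<open>auto intro: measurable_completion\<close>)
  then have gi: "integrable (lborel \<Otimes>\<^sub>M lborel) g"
    using gb by (simp add: integrable_completion lborel_prod)
  have AEx: "AE x in lebesgue. x \<in> S \<longrightarrow> (AE y in lebesgue. indicator T y * f (x, y) = g (x, y))"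
    using g(3)
  proof eventually_elim
    case (elim x)
    then show ?case
      by (auto simp: indicator_def elim!: eventually_mono)
  qed
  have AEx2: "AE x in lebesgue. integrable lebesgue (\<lambda>y. g (x, y))"
    using lborel_pair.AE_integrable_fst'[OF gi] gx
    by (simp add: AE_completion_iff integrable_completion)
  have ae0: "AE x in lebesgue. x \<notin> S \<longrightarrow> (AE y in lebesgue. g (x, y) = 0)"
    using g(3) by eventually_elim (auto elim!: eventually_mono)
  have transfer: "AE x in lebesgue. x \<in> S \<longrightarrow> integrable (lebesgue_on T) (\<lambda>y. f (x, y)) \<and>
      (LINT y|lebesgue_on T. f (x, y)) = (LINT y|lborel. g (x, y))"
    using AEx AEx2
  proof eventually_elim
    case (elim x)
    show ?case
    proof
      assume "x \<in> S"
      with elim have ae: "AE y in lebesgue. g (x, y) = indicator T y *\<^sub>R f (x, y)"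
        by (auto elim: eventually_mono)
      have m: "(\<lambda>y. g (x, y)) \<in> borel_measurable lebesgue"
        using gx[of x] by (auto intro: measurable_completion)
      then have m2: "(\<lambda>y. indicator T y *\<^sub>R f (x, y)) \<in> borel_measurable lebesgue"
        by (rule borel_measurable_AE[OF _ ae])
      have "integrable lebesgue (\<lambda>y. indicator T y *\<^sub>R f (x, y))"
        using elim(2) by (rule iffD1[OF integrable_cong_AE[OF m m2 ae]])
      moreover have "(LINT y|lebesgue. g (x, y)) = (LINT y|lebesgue. indicator T y *\<^sub>R f (x, y))"
        by (rule integral_cong_AE[OF m m2 ae])
      ultimately show "integrable (lebesgue_on T) (\<lambda>y. f (x, y)) \<and>
          (LINT y|lebesgue_on T. f (x, y)) = (LINT y|lborel. g (x, y))"
        using T gx[of x] by (simp add: integrable_restrict_space integral_restrict_space integral_completion)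
    qed
  qed
  show "AE x in lebesgue_on S. integrable (lebesgue_on T) (\<lambda>y. f (x, y))"
    unfolding AE_lebesgue_on_iff[OF S] using transfer by eventually_elim auto
  have Gi: "integrable lebesgue (\<lambda>x. LINT y|lborel. g (x, y))"
    using lborel_pair.integrable_fst'[OF gi]
    by (subst integrable_completion) auto
  have ae: "AE x in lebesgue. (LINT y|lborel. g (x, y)) =
      indicator S x *\<^sub>R (LINT y|lebesgue_on T. f (x, y))"
    using transfer ae0
  proof eventually_elim
    case (elim x)
    show ?case
    proof (cases "x \<in> S")
      case False
      with elim have "AE y in lborel. g (x, y) = 0" by (simp add: AE_completion_iff)
      then have "(LINT y|lborel. g (x, y)) = 0" by (rule integral_eq_zero_AE)
      with False show ?thesis by simp
    qed (use elim in auto)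
  qed
  have Gm: "(\<lambda>x. LINT y|lborel. g (x, y)) \<in> borel_measurable lebesgue"
    using Gi by auto
  have Fm: "(\<lambda>x. indicator S x *\<^sub>R (LINT y|lebesgue_on T. f (x, y))) \<in> borel_measurable lebesgue"
    by (rule borel_measurable_AE[OF Gm ae])
  show "integrable (lebesgue_on S) (\<lambda>x. LINT y|lebesgue_on T. f (x, y))"
    using S Gi iffD1[OF integrable_cong_AE[OF Gm Fm ae]] by (simp add: integrable_restrict_space)
  have "(LINT z|lebesgue_on (S \<times> T). f z) = (LINT z|lebesgue. indicator (S \<times> T) z *\<^sub>R f z)"
    using o by (simp add: integral_restrict_space)
  also have "\<dots> = (LINT z|lebesgue. g z)"
    by (rule integral_cong_AE) (use g(2) gb fi in \<open>auto intro: measurable_completion\<close>)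
  also have "\<dots> = (LINT z|(lborel \<Otimes>\<^sub>M lborel). g z)"
    using gb by (simp add: integral_completion lborel_prod)
  also have "\<dots> = (LINT x|lborel. LINT y|lborel. g (x, y))"
    using lborel_pair.integral_fst'[OF gi] by simp
  also have "\<dots> = (LINT x|lebesgue. LINT y|lborel. g (x, y))"
    using lborel_pair.integrable_fst'[OF gi] by (subst integral_completion) auto
  also have "\<dots> = (LINT x|lebesgue. indicator S x *\<^sub>R (LINT y|lebesgue_on T. f (x, y)))"
    by (rule integral_cong_AE[OF Gm Fm ae])
  also have "\<dots> = (LINT x|lebesgue_on S. LINT y|lebesgue_on T. f (x, y))"
    using S by (simp add: integral_restrict_space)
  finally show "(LINT z|lebesgue_on (S \<times> T). f z) =
      (LINT x|lebesgue_on S. LINT y|lebesgue_on T. f (x, y))" .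
qed

lemma Tonelli_lebesgue_on_swap:
  fixes f :: "'a::euclidean_space \<times> 'b::euclidean_space \<Rightarrow> real"
  assumes S: "open S" and T: "open T" and f: "f \<in> borel_measurable (lebesgue_on (S \<times> T))"
  shows "AE y in lebesgue_on T. (\<lambda>x. f (x, y)) \<in> borel_measurable (lebesgue_on S)"
    and "(\<integral>\<^sup>+z. ennreal (f z) \<partial>lebesgue_on (S \<times> T)) =
         (\<integral>\<^sup>+y. (\<integral>\<^sup>+x. ennreal (f (x, y)) \<partial>lebesgue_on S) \<partial>lebesgue_on T)"
proof -
  have m: "(\<lambda>z. f (prod.swap z)) \<in> borel_measurable (lebesgue_on (T \<times> S))"
    by (rule measurable_compose[OF swap_measurable_lebesgue_on f])
  show "AE y in lebesgue_on T. (\<lambda>x. f (x, y)) \<in> borel_measurable (lebesgue_on S)"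
    using Tonelli_lebesgue_on(1)[OF T S m] by simp
  show "(\<integral>\<^sup>+z. ennreal (f z) \<partial>lebesgue_on (S \<times> T)) =
         (\<integral>\<^sup>+y. (\<integral>\<^sup>+x. ennreal (f (x, y)) \<partial>lebesgue_on S) \<partial>lebesgue_on T)"
    using Tonelli_lebesgue_on(2)[OF T S m] nn_integral_lebesgue_on_swap[OF T S, of "\<lambda>z. ennreal (f z)"] f
    by simp
qed

lemma Fubini_lebesgue_on_swap:
  fixes f :: "'a::euclidean_space \<times> 'b::euclidean_space \<Rightarrow> real"
  assumes S: "open S" and T: "open T" and f: "integrable (lebesgue_on (S \<times> T)) f"
  shows "AE y in lebesgue_on T. integrable (lebesgue_on S) (\<lambda>x. f (x, y))"
    and "integrable (lebesgue_on T) (\<lambda>y. LINT x|lebesgue_on S. f (x, y))"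
    and "(LINT z|lebesgue_on (S \<times> T). f z) = (LINT y|lebesgue_on T. LINT x|lebesgue_on S. f (x, y))"
proof -
  have fm: "f \<in> borel_measurable (lebesgue_on (S \<times> T))" using f by auto
  have i: "integrable (lebesgue_on (T \<times> S)) (\<lambda>z. f (prod.swap z))"
    using lebesgue_on_swap(1)[OF T S fm] f by simp
  note F = Fubini_lebesgue_on[OF T S i]
  show "AE y in lebesgue_on T. integrable (lebesgue_on S) (\<lambda>x. f (x, y))"
    and "integrable (lebesgue_on T) (\<lambda>y. LINT x|lebesgue_on S. f (x, y))"
    and "(LINT z|lebesgue_on (S \<times> T). f z) = (LINT y|lebesgue_on T. LINT x|lebesgue_on S. f (x, y))"
    using F lebesgue_on_swap(2)[OF T S fm] by simp_all
qed

section \<open>Semi-inner products and orthonormal bases\<close>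

text \<open>
  The three forms in use, namely the \<open>L\<^sup>2\<close> product, the gradient product and their sum, are positive
  semidefinite on spaces of functions that are not identified when they agree almost everywhere.
  The arguments are by Pythagoras and the parallelogram law, and a basis is recognised by Parseval's
  identity.
\<close>

locale function_semi_inner =
  fixes V :: "('a \<Rightarrow> real) set" and ip :: "('a \<Rightarrow> real) \<Rightarrow> ('a \<Rightarrow> real) \<Rightarrow> real"
  assumes zero_mem: "(\<lambda>x. 0) \<in> V"
    and add_mem: "u \<in> V \<Longrightarrow> v \<in> V \<Longrightarrow> (\<lambda>x. u x + v x) \<in> V"
    and scale_mem: "u \<in> V \<Longrightarrow> (\<lambda>x. c * u x) \<in> V"
    and ip_commute: "ip u v = ip v u"
    and ip_add: "u \<in> V \<Longrightarrow> v \<in> V \<Longrightarrow> w \<in> V \<Longrightarrow> ip (\<lambda>x. u x + v x) w = ip u w + ip v w"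
    and ip_scale: "u \<in> V \<Longrightarrow> w \<in> V \<Longrightarrow> ip (\<lambda>x. c * u x) w = c * ip u w"
    and ip_nonneg: "u \<in> V \<Longrightarrow> ip u u \<ge> 0"
begin

lemma diff_mem: "u \<in> V \<Longrightarrow> v \<in> V \<Longrightarrow> (\<lambda>x. u x - v x) \<in> V"
  using add_mem[of u "\<lambda>x. - 1 * v x"] scale_mem[of v "-1"] by simp

lemma ip_zero: "w \<in> V \<Longrightarrow> ip (\<lambda>x. 0) w = 0"
  using ip_scale[of "\<lambda>x. 0" w 0] zero_mem by simp

lemma ip_diff: "u \<in> V \<Longrightarrow> v \<in> V \<Longrightarrow> w \<in> V \<Longrightarrow> ip (\<lambda>x. u x - v x) w = ip u w - ip v w"
  using ip_add[of u "\<lambda>x. - 1 * v x" w] scale_mem[of v "-1"] ip_scale[of v w "-1"] by simp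

lemma sum_mem: "(\<And>i. i \<in> F \<Longrightarrow> e i \<in> V) \<Longrightarrow> (\<lambda>x. \<Sum>i\<in>F. c i * e i x) \<in> V"
  by (induction F rule: infinite_finite_induct) (auto intro!: zero_mem add_mem scale_mem)

lemma ip_sum:
  "(\<And>i. i \<in> F \<Longrightarrow> e i \<in> V) \<Longrightarrow> w \<in> V \<Longrightarrow> ip (\<lambda>x. \<Sum>i\<in>F. c i * e i x) w = (\<Sum>i\<in>F. c i * ip (e i) w)"
  by (induction F rule: infinite_finite_induct)
     (auto simp: ip_zero ip_add ip_scale sum_mem scale_mem)

lemma ip_diff_self:
  "u \<in> V \<Longrightarrow> v \<in> V \<Longrightarrow> ip (\<lambda>x. u x - v x) (\<lambda>x. u x - v x) = ip u u - 2 * ip u v + ip v v"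
  using ip_diff[of u v "\<lambda>x. u x - v x"] ip_diff[of u v u] ip_diff[of u v v]
  by (simp add: diff_mem ip_commute)

text \<open>
  The parallelogram law without its nonnegative difference term. It replaces the triangle inequality
  throughout, at the price of a factor that is harmless in approximation arguments.
\<close>
lemma ip_add_self_le:
  assumes "u \<in> V" "v \<in> V"
  shows "ip (\<lambda>x. u x + v x) (\<lambda>x. u x + v x) \<le> 2 * ip u u + 2 * ip v v"
proof -
  have "ip (\<lambda>x. u x + v x) (\<lambda>x. u x + v x) = ip u u + 2 * ip u v + ip v v"
    using ip_add[of u v "\<lambda>x. u x + v x"] ip_add[of u v u] ip_add[of u v v] assms
    by (simp add: add_mem ip_commute)
  with ip_nonneg[OF diff_mem[OF assms]] show ?thesis
    by (simp add: ip_diff_self assms)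
qed

lemma ip_triangle_le:
  assumes "u \<in> V" "v \<in> V" "w \<in> V"
  shows "ip (\<lambda>x. u x - w x) (\<lambda>x. u x - w x) \<le>
    2 * ip (\<lambda>x. u x - v x) (\<lambda>x. u x - v x) + 2 * ip (\<lambda>x. v x - w x) (\<lambda>x. v x - w x)"
  using ip_add_self_le[of "\<lambda>x. u x - v x" "\<lambda>x. v x - w x"] assms by (simp add: diff_mem)

text \<open>
  Completing the square: the error of a linear combination is smallest for the Fourier
  coefficients, and the excess of any other choice is the squared distance of the coefficients.
\<close>
lemma ip_residual:
  assumes fin: "finite F" and e: "\<And>i. e i \<in> V"
    and on: "\<And>i j. ip (e i) (e j) = (if i = j then 1 else 0)" and v: "v \<in> V"
  shows "ip (\<lambda>x. v x - (\<Sum>i\<in>F. c i * e i x)) (\<lambda>x. v x - (\<Sum>i\<in>F. c i * e i x)) =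
    ip v v - (\<Sum>i\<in>F. (ip v (e i))\<^sup>2) + (\<Sum>i\<in>F. (c i - ip v (e i))\<^sup>2)"
proof -
  let ?s = "\<lambda>x. \<Sum>i\<in>F. c i * e i x"
  have s: "?s \<in> V" by (intro sum_mem e)
  have "ip v ?s = (\<Sum>i\<in>F. c i * ip v (e i))"
    by (subst ip_commute, subst ip_sum) (auto simp: e v ip_commute)
  moreover have "ip ?s ?s = (\<Sum>i\<in>F. c i * c i)"
  proof -
    have "ip (e i) ?s = (if i \<in> F then c i else 0)" for i
      using fin by (subst ip_commute, subst ip_sum) (auto simp: e on if_distrib[of "(*) _"] cong: if_cong)
    then show ?thesis
      by (subst ip_sum) (auto simp: e s intro!: sum.cong)
  qed
  ultimately show ?thesis
    unfolding ip_diff_self[OF v s]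
    by (simp add: sum.distrib sum_subtractf power2_eq_square sum_distrib_left algebra_simps)
qed

lemma Bessel_finite:
  assumes fin: "finite F" and e: "\<And>i. e i \<in> V"
    and on: "\<And>i j. ip (e i) (e j) = (if i = j then 1 else 0)" and v: "v \<in> V"
  shows "(\<Sum>i\<in>F. (ip v (e i))\<^sup>2) \<le> ip v v"
  using ip_residual[OF assms, of "\<lambda>i. ip v (e i)"]
    ip_nonneg[OF diff_mem[OF v sum_mem[of F e "\<lambda>i. ip v (e i)"]]] e by simp

text \<open>
  If some combination approximates \<open>v\<close>, the one with Fourier coefficients does so at least as well,
  and its error is the defect in Bessel's inequality.
\<close>
lemma Parseval_finite:
  assumes b: "orthonormal_basis W ip e" and W: "W \<subseteq> V" and v: "v \<in> W" and "\<epsilon> > 0"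
  obtains F where "finite F" "ip v v - (\<Sum>i\<in>F. (ip v (e i))\<^sup>2) < \<epsilon>"
proof -
  have e: "e i \<in> V" and on: "ip (e i) (e j) = (if i = j then 1 else 0)" for i j
    using b W by (auto simp: orthonormal_basis_def)
  have "sqrt \<epsilon> > 0" using \<open>\<epsilon> > 0\<close> by simp
  then obtain F c where F: "finite F" "sqrt (ip (\<lambda>x. v x - (\<Sum>i\<in>F. c i * e i x))
      (\<lambda>x. v x - (\<Sum>i\<in>F. c i * e i x))) < sqrt \<epsilon>"
    using b v unfolding orthonormal_basis_def Let_def by blast
  have "ip v v - (\<Sum>i\<in>F. (ip v (e i))\<^sup>2) + (\<Sum>i\<in>F. (c i - ip v (e i))\<^sup>2) < \<epsilon>"
    using F(2) v W ip_residual[OF F(1) e on, of v c] by auto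
  moreover have "(\<Sum>i\<in>F. (c i - ip v (e i))\<^sup>2) \<ge> 0" by (intro sum_nonneg) auto
  ultimately show ?thesis using that[OF F(1)] by simp
qed

lemma Parseval_suminf:
  fixes e :: "nat \<Rightarrow> 'a \<Rightarrow> real"
  assumes b: "orthonormal_basis W ip e" and W: "W \<subseteq> V" and v: "v \<in> W"
  shows "(\<Sum>i. ennreal ((ip v (e i))\<^sup>2)) = ennreal (ip v v)"
proof (rule antisym)
  have e: "e i \<in> V" and on: "ip (e i) (e j) = (if i = j then 1 else 0)" for i j
    using b W by (auto simp: orthonormal_basis_def)
  show "(\<Sum>i. ennreal ((ip v (e i))\<^sup>2)) \<le> ennreal (ip v v)"
    unfolding suminf_eq_SUP
    using Bessel_finite[OF _ e on, of _ v] v W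
    by (intro SUP_least) (auto simp: sum_ennreal intro!: ennreal_leI)
  show "ennreal (ip v v) \<le> (\<Sum>i. ennreal ((ip v (e i))\<^sup>2))"
  proof (rule ennreal_le_epsilon)
    fix \<epsilon> :: real assume "\<epsilon> > 0"
    then obtain F where F: "finite F" "ip v v - (\<Sum>i\<in>F. (ip v (e i))\<^sup>2) < \<epsilon>"
      using Parseval_finite[OF b W v] by blast
    have "ennreal (ip v v) \<le> ennreal ((\<Sum>i\<in>F. (ip v (e i))\<^sup>2) + \<epsilon>)"
      using F(2) by (intro ennreal_leI) auto
    also have "\<dots> = (\<Sum>i\<in>F. ennreal ((ip v (e i))\<^sup>2)) + ennreal \<epsilon>"
      using \<open>\<epsilon> > 0\<close> by (simp add: ennreal_plus sum_nonneg sum_ennreal)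
    also have "\<dots> \<le> (\<Sum>i. ennreal ((ip v (e i))\<^sup>2)) + ennreal \<epsilon>"
      by (intro add_right_mono sum_le_suminf F(1)) auto
    finally show "ennreal (ip v v) \<le> (\<Sum>i. ennreal ((ip v (e i))\<^sup>2)) + ennreal \<epsilon>" .
  qed
qed

definition approximable :: "('a \<Rightarrow> real) set \<Rightarrow> ('a \<Rightarrow> real) \<Rightarrow> bool" where
  "approximable D v \<longleftrightarrow> (\<forall>\<epsilon>>0. \<exists>d\<in>D. ip (\<lambda>x. v x - d x) (\<lambda>x. v x - d x) < \<epsilon>)"

lemma approximable_trans:
  assumes D: "D \<subseteq> V" and E: "E \<subseteq> V" and v: "v \<in> V" and "approximable E v" and "\<And>w. w \<in> E \<Longrightarrow> approximable D w"
  shows "approximable D v"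
  unfolding approximable_def
proof (intro allI impI)
  fix \<epsilon> :: real assume "\<epsilon> > 0"
  then have "\<epsilon> / 4 > 0" by simp
  then obtain w where w: "w \<in> E" "ip (\<lambda>x. v x - w x) (\<lambda>x. v x - w x) < \<epsilon> / 4"
    using assms unfolding approximable_def by blast
  obtain d where d: "d \<in> D" "ip (\<lambda>x. w x - d x) (\<lambda>x. w x - d x) < \<epsilon> / 4"
    using assms(5)[OF w(1)] \<open>\<epsilon> / 4 > 0\<close> unfolding approximable_def by blast
  have "ip (\<lambda>x. v x - d x) (\<lambda>x. v x - d x) < \<epsilon>"
    using ip_triangle_le[of v w d] w d v subsetD[OF D d(1)] subsetD[OF E w(1)] by auto
  with d(1) show "\<exists>d\<in>D. ip (\<lambda>x. v x - d x) (\<lambda>x. v x - d x) < \<epsilon>" by blast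
qed

lemma approximable_scale:
  assumes D: "D \<subseteq> V" "\<And>u c. u \<in> D \<Longrightarrow> (\<lambda>x. c * u x) \<in> D" and v: "v \<in> V" "approximable D v"
  shows "approximable D (\<lambda>x. c * v x)"
  unfolding approximable_def
proof (intro allI impI)
  fix \<epsilon> :: real assume "\<epsilon> > 0"
  then have "\<epsilon> / (c\<^sup>2 + 1) > 0" by (simp add: add_nonneg_pos)
  then obtain d where d: "d \<in> D" "ip (\<lambda>x. v x - d x) (\<lambda>x. v x - d x) < \<epsilon> / (c\<^sup>2 + 1)"
    using v unfolding approximable_def by blast
  let ?r = "\<lambda>x. v x - d x"
  have r: "?r \<in> V" using d v D by (auto intro: diff_mem)
  have "ip (\<lambda>x. c * ?r x) (\<lambda>x. c * ?r x) = c\<^sup>2 * ip ?r ?r"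
    using ip_scale[OF r scale_mem[OF r], of c c] ip_scale[OF r r, of c]
      ip_commute[of ?r "\<lambda>x. c * ?r x"]
    by (simp add: power2_eq_square)
  also have "\<dots> \<le> (c\<^sup>2 + 1) * ip ?r ?r"
    using ip_nonneg[OF r] by (intro mult_right_mono) auto
  also have "\<dots> < \<epsilon>"
    using d(2) by (simp add: pos_less_divide_eq add_nonneg_pos mult.commute)
  finally have "ip (\<lambda>x. c * v x - c * d x) (\<lambda>x. c * v x - c * d x) < \<epsilon>"
    by (simp add: right_diff_distrib)
  then show "\<exists>d\<in>D. ip (\<lambda>x. c * v x - d x) (\<lambda>x. c * v x - d x) < \<epsilon>"
    by (intro bexI[OF _ D(2)[OF d(1)]])
qed

lemma approximable_add:
  assumes D: "D \<subseteq> V" "\<And>u v. u \<in> D \<Longrightarrow> v \<in> D \<Longrightarrow> (\<lambda>x. u x + v x) \<in> D"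
    and u: "u \<in> V" "approximable D u" and v: "v \<in> V" "approximable D v"
  shows "approximable D (\<lambda>x. u x + v x)"
  unfolding approximable_def
proof (intro allI impI)
  fix \<epsilon> :: real assume "\<epsilon> > 0"
  then have "\<epsilon> / 4 > 0" by simp
  then obtain a b where a: "a \<in> D" "ip (\<lambda>x. u x - a x) (\<lambda>x. u x - a x) < \<epsilon> / 4"
    and b: "b \<in> D" "ip (\<lambda>x. v x - b x) (\<lambda>x. v x - b x) < \<epsilon> / 4"
    using u v unfolding approximable_def by blast
  have "ip (\<lambda>x. (u x - a x) + (v x - b x)) (\<lambda>x. (u x - a x) + (v x - b x)) < \<epsilon>"
    using ip_add_self_le[of "\<lambda>x. u x - a x" "\<lambda>x. v x - b x"] a b u v D by (auto simp: diff_mem subsetD)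
  moreover have "(u x - a x) + (v x - b x) = u x + v x - (a x + b x)" for x by simp
  ultimately have "ip (\<lambda>x. u x + v x - (a x + b x)) (\<lambda>x. u x + v x - (a x + b x)) < \<epsilon>" by simp
  then show "\<exists>d\<in>D. ip (\<lambda>x. u x + v x - d x) (\<lambda>x. u x + v x - d x) < \<epsilon>"
    by (intro bexI[OF _ D(2)[OF a(1) b(1)]])
qed

lemma approximable_self: "d \<in> D \<Longrightarrow> D \<subseteq> V \<Longrightarrow> approximable D d"
  unfolding approximable_def by (intro allI impI bexI[of _ d]) (auto simp: ip_zero zero_mem)

text \<open>
  A subspace whose closure contains the basis vectors is dense. Applied to test functions, this turns
  membership of the eigenfunctions in \<open>H\<^sub>0\<^sup>1\<close> into density of test functions in \<open>L\<^sup>2\<close>.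
\<close>
lemma orthonormal_basis_imp_approximable:
  assumes b: "orthonormal_basis W ip e" and W: "W \<subseteq> V" and D: "D \<subseteq> V" "(\<lambda>x. 0) \<in> D"
    and D_add: "\<And>u v. u \<in> D \<Longrightarrow> v \<in> D \<Longrightarrow> (\<lambda>x. u x + v x) \<in> D"
    and D_scale: "\<And>u c. u \<in> D \<Longrightarrow> (\<lambda>x. c * u x) \<in> D"
    and eD: "\<And>i. approximable D (e i)" and v: "v \<in> W"
  shows "approximable D v"
proof (rule approximable_trans)
  let ?E = "{s. s \<in> V \<and> (\<exists>F c. s = (\<lambda>x. \<Sum>i\<in>F. c i * e i x))}"
  have e: "e i \<in> V" for i using b W by (auto simp: orthonormal_basis_def)
  show "approximable ?E v"
    unfolding approximable_def
  proof (intro allI impI)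
    fix \<epsilon> :: real assume "\<epsilon> > 0"
    then have "sqrt \<epsilon> > 0" by simp
    then obtain F c where "sqrt (ip (\<lambda>x. v x - (\<Sum>i\<in>F. c i * e i x))
        (\<lambda>x. v x - (\<Sum>i\<in>F. c i * e i x))) < sqrt \<epsilon>"
      using b v unfolding orthonormal_basis_def Let_def by blast
    moreover have "(\<lambda>x. \<Sum>i\<in>F. c i * e i x) \<in> ?E" 
      by (intro CollectI conjI exI[of _ F] exI[of _ c] refl, rule sum_mem, rule e)
    ultimately show "\<exists>d\<in>?E. ip (\<lambda>x. v x - d x) (\<lambda>x. v x - d x) < \<epsilon>"
      by (intro bexI[of _ "\<lambda>x. \<Sum>i\<in>F. c i * e i x"]) (simp only: real_sqrt_less_iff)
  qed
  show "approximable D w" if w: "w \<in> ?E" for w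
  proof -
    have "approximable D (\<lambda>x. \<Sum>i\<in>F. c i * e i x)" for F c
    proof (induction F rule: infinite_finite_induct)
      case (insert i F)
      have "approximable D (\<lambda>x. c i * e i x + (\<Sum>i\<in>F. c i * e i x))"
        using approximable_scale[OF D(1) D_scale e eD] insert.IH
        by (intro approximable_add[OF D(1) D_add] scale_mem[OF e] sum_mem[OF e])
      with insert.hyps show ?case by simp
    qed (use approximable_self[OF D(2,1)] in auto)
    with w show ?thesis by auto
  qed
  show "v \<in> V" "?E \<subseteq> V" "D \<subseteq> V" using v W D by auto
qed

text \<open>
  A dense subset \<open>D\<close> suffices for Parseval's identity, here in the form that finite partial sums
  exhaust the squared norm. For \<open>H\<^sub>0\<^sup>1\<close> of the product this subset consists of the test functions, all of whose
  slices are test functions as well.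
\<close>
lemma orthonormal_basisI:
  assumes e: "\<And>i. e i \<in> W" and W: "W \<subseteq> V"
    and on: "\<And>i j. ip (e i) (e j) = (if i = j then 1 else 0)"
    and D: "D \<subseteq> V" "\<And>v. v \<in> W \<Longrightarrow> approximable D v"
    and Parseval: "\<And>d \<epsilon>. d \<in> D \<Longrightarrow> \<epsilon> > 0 \<Longrightarrow> \<exists>F. finite F \<and> ip d d - (\<Sum>i\<in>F. (ip d (e i))\<^sup>2) < \<epsilon>"
  shows "orthonormal_basis W ip e"
proof -
  have eV: "e i \<in> V" for i using e W by auto
  have "\<exists>F c. finite F \<and> sqrt (ip (\<lambda>x. v x - (\<Sum>i\<in>F. c i * e i x)) (\<lambda>x. v x - (\<Sum>i\<in>F. c i * e i x))) < \<epsilon>"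
    if v: "v \<in> W" and "\<epsilon> > 0" for v \<epsilon>
  proof -
  have \<epsilon>: "\<epsilon>\<^sup>2 / 4 > 0" using \<open>\<epsilon> > 0\<close> by simp
  obtain d where d: "d \<in> D" "ip (\<lambda>x. v x - d x) (\<lambda>x. v x - d x) < \<epsilon>\<^sup>2 / 4"
    using D(2)[OF v] \<epsilon> unfolding approximable_def by meson
  obtain F where F: "finite F" "ip d d - (\<Sum>i\<in>F. (ip d (e i))\<^sup>2) < \<epsilon>\<^sup>2 / 4"
    using Parseval[OF d(1) \<epsilon>] by blast
  let ?s = "\<lambda>x. \<Sum>i\<in>F. ip d (e i) * e i x"
  have dV: "d \<in> V" using d D by auto
  have "ip (\<lambda>x. d x - ?s x) (\<lambda>x. d x - ?s x) < \<epsilon>\<^sup>2 / 4"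
    using F(2) by (subst ip_residual[OF F(1) eV on dV]) simp
  then have "ip (\<lambda>x. v x - ?s x) (\<lambda>x. v x - ?s x) < \<epsilon>\<^sup>2"
    using ip_triangle_le[of v d ?s] d dV v W sum_mem[of F e "\<lambda>i. ip d (e i)"] eV by auto
  then have "sqrt (ip (\<lambda>x. v x - ?s x) (\<lambda>x. v x - ?s x)) < \<epsilon>"
    using \<open>\<epsilon> > 0\<close> by (simp add: real_less_lsqrt less_imp_le)
    with F(1) show ?thesis by (intro exI[of _ F] exI[of _ "\<lambda>i. ip d (e i)"] conjI)
  qed
  then show ?thesis
    using e on unfolding orthonormal_basis_def Let_def by simp
qed

end

text \<open>
  Write \<open>e \<otimes> f - a \<otimes> b = (e - a) \<otimes> f + a \<otimes> (f - b)\<close>, choose \<open>a\<close> close to \<open>e\<close> in terms of the size of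
  \<open>f\<close>, and only then \<open>b\<close> close to \<open>f\<close> in terms of the size of \<open>a\<close>. The norm enters through the
  submultiplicative bound on tensors, which both the \<open>L\<^sup>2\<close> norm and the \<open>H\<^sup>1\<close> norm satisfy.
\<close>
lemma tensor_approximable:
  assumes "function_semi_inner V ip" "function_semi_inner V1 ip1" "function_semi_inner V2 ip2"
    and mem: "\<And>a b. a \<in> V1 \<Longrightarrow> b \<in> V2 \<Longrightarrow> tensor a b \<in> V"
    and bound: "\<And>a b. a \<in> V1 \<Longrightarrow> b \<in> V2 \<Longrightarrow> ip (tensor a b) (tensor a b) \<le> ip1 a a * ip2 b b"
    and D1: "D1 \<subseteq> V1" and D2: "D2 \<subseteq> V2"
    and D: "\<And>a b. a \<in> D1 \<Longrightarrow> b \<in> D2 \<Longrightarrow> tensor a b \<in> D"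
    and e: "e \<in> V1" "function_semi_inner.approximable ip1 D1 e"
    and f: "f \<in> V2" "function_semi_inner.approximable ip2 D2 f"
  shows "function_semi_inner.approximable ip D (tensor e f)"
proof -
  interpret P: function_semi_inner V ip by fact
  interpret A: function_semi_inner V1 ip1 by fact
  interpret B: function_semi_inner V2 ip2 by fact
  show ?thesis
    unfolding P.approximable_def
  proof (intro allI impI)
    fix \<epsilon> :: real assume "\<epsilon> > 0"
    have f0: "ip2 f f \<ge> 0" by (rule B.ip_nonneg[OF f(1)])
    \<comment> \<open>The summand \<open>1\<close> keeps the denominators positive when \<open>f\<close> or \<open>a\<close> has norm zero.\<close>
    have p2: "4 * (ip2 f f + 1) > 0" using f0 by (simp add: add_nonneg_pos)
    obtain a where a: "a \<in> D1" "ip1 (\<lambda>x. e x - a x) (\<lambda>x. e x - a x) < \<epsilon> / (4 * (ip2 f f + 1))"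
      using divide_pos_pos[OF \<open>\<epsilon> > 0\<close> p2] e(2) unfolding A.approximable_def by meson
    have a0: "ip1 a a \<ge> 0" using a D1 by (auto intro: A.ip_nonneg)
    have p1: "4 * (ip1 a a + 1) > 0" using a0 by (simp add: add_nonneg_pos)
    obtain b where b: "b \<in> D2" "ip2 (\<lambda>x. f x - b x) (\<lambda>x. f x - b x) < \<epsilon> / (4 * (ip1 a a + 1))"
      using divide_pos_pos[OF \<open>\<epsilon> > 0\<close> p1] f(2) unfolding B.approximable_def by meson
    let ?ea = "\<lambda>x. e x - a x" and ?fb = "\<lambda>x. f x - b x"
    have V: "?ea \<in> V1" "?fb \<in> V2" "a \<in> V1"
      using a b e f D1 D2 by (auto intro: A.diff_mem B.diff_mem)
    have eq: "tensor e f z - tensor a b z = tensor ?ea f z + tensor a ?fb z" for z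
      by (auto simp: tensor_def algebra_simps split: prod.splits)
    have "ip (tensor ?ea f) (tensor ?ea f) \<le> \<epsilon> / (4 * (ip2 f f + 1)) * ip2 f f"
      using bound[OF V(1) f(1)] mult_right_mono[OF less_imp_le[OF a(2)] f0] by linarith
    also have "\<dots> < \<epsilon> / 4" using \<open>\<epsilon> > 0\<close> p2 mult_pos_pos[OF \<open>\<epsilon> > 0\<close> p2] by (simp add: divide_simps) (simp add: algebra_simps)?
    finally have 1: "ip (tensor ?ea f) (tensor ?ea f) < \<epsilon> / 4" .
    have "ip (tensor a ?fb) (tensor a ?fb) \<le> ip1 a a * (\<epsilon> / (4 * (ip1 a a + 1)))"
      using bound[OF V(3) V(2)] mult_left_mono[OF less_imp_le[OF b(2)] a0] by linarith
    also have "\<dots> < \<epsilon> / 4" using \<open>\<epsilon> > 0\<close> p1 mult_pos_pos[OF \<open>\<epsilon> > 0\<close> p1] by (simp add: divide_simps) (simp add: algebra_simps)?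
    finally have 2: "ip (tensor a ?fb) (tensor a ?fb) < \<epsilon> / 4" .
    have "ip (\<lambda>z. tensor e f z - tensor a b z) (\<lambda>z. tensor e f z - tensor a b z) < \<epsilon>"
      unfolding eq using P.ip_add_self_le[OF mem[OF V(1) f(1)] mem[OF V(3) V(2)]] 1 2 by linarith
    then show "\<exists>d\<in>D. ip (\<lambda>x. tensor e f x - d x) (\<lambda>x. tensor e f x - d x) < \<epsilon>"
      by (rule bexI[OF _ D[OF a(1) b(1)]])
  qed
qed

text \<open>
  Passes from a double series of nonnegative terms to the finite subfamilies of pairs that
  \<open>orthonormal_basisI\<close> asks for.
\<close>
lemma double_suminf_finite_approx:
  fixes a :: "nat \<Rightarrow> nat \<Rightarrow> real"
  assumes nn: "\<And>j k. a j k \<ge> 0" and s: "(\<Sum>j. \<Sum>k. ennreal (a j k)) = ennreal S" and "S \<ge> 0" "\<epsilon> > 0"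
  shows "\<exists>F. finite F \<and> S - (\<Sum>(j, k)\<in>F. a j k) < \<epsilon>"
proof (cases "S < \<epsilon>")
  case True
  then show ?thesis by (intro exI[of _ "{}"]) auto
next
  case False
  then have "ennreal (S - \<epsilon>) < (\<Sum>j. \<Sum>k. ennreal (a j k))"
    using \<open>\<epsilon> > 0\<close> by (simp add: s ennreal_less_iff)
  then obtain m where m: "ennreal (S - \<epsilon>) < (\<Sum>j<m. \<Sum>k. ennreal (a j k))"
    unfolding suminf_eq_SUP[of "\<lambda>j. \<Sum>k. ennreal (a j k)"] less_SUP_iff by blast
  have "(\<Sum>j<m. \<Sum>k. ennreal (a j k)) = (\<Sum>k. \<Sum>j<m. ennreal (a j k))"
    by (simp add: suminf_sum)
  with m obtain n where n: "ennreal (S - \<epsilon>) < (\<Sum>k<n. \<Sum>j<m. ennreal (a j k))"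
    unfolding suminf_eq_SUP[of "\<lambda>k. \<Sum>j<m. ennreal (a j k)"] by (auto simp: less_SUP_iff)
  also have "\<dots> = (\<Sum>j<m. \<Sum>k<n. ennreal (a j k))" by (rule sum.swap)
  also have "\<dots> = ennreal (\<Sum>(j, k)\<in>{..<m} \<times> {..<n}. a j k)"
    by (simp add: sum_ennreal nn sum_nonneg sum.cartesian_product)
  finally have "S - \<epsilon> < (\<Sum>(j, k)\<in>{..<m} \<times> {..<n}. a j k)"
    using False by (simp add: ennreal_less_iff)
  then show ?thesis by (intro exI[of _ "{..<m} \<times> {..<n}"]) auto
qed

section \<open>Square integrable functions\<close>

lemma L2_add:
  fixes f g :: "'a::euclidean_space \<Rightarrow> 'b::euclidean_space"
  assumes "f \<in> L2 \<Omega>" "g \<in> L2 \<Omega>"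
  shows "(\<lambda>x. f x + g x) \<in> L2 \<Omega>"
proof -
  have m: "f \<in> borel_measurable (lebesgue_on \<Omega>)" "g \<in> borel_measurable (lebesgue_on \<Omega>)"
    using assms by (auto simp: L2_def)
  have "integrable (lebesgue_on \<Omega>) (\<lambda>x. (norm (f x + g x))\<^sup>2)"
  proof (rule Bochner_Integration.integrable_bound)
    show "integrable (lebesgue_on \<Omega>) (\<lambda>x. 2 * (norm (f x))\<^sup>2 + 2 * (norm (g x))\<^sup>2)"
      using assms by (auto simp: L2_def)
    have "(norm (a + b))\<^sup>2 \<le> 2 * (norm a)\<^sup>2 + 2 * (norm b)\<^sup>2" for a b :: 'b
    proof -
      have "(norm (a + b))\<^sup>2 \<le> (norm a + norm b)\<^sup>2"
        by (intro power_mono norm_triangle_ineq) auto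
      also have "\<dots> \<le> 2 * (norm a)\<^sup>2 + 2 * (norm b)\<^sup>2"
        using sum_squares_bound[of "norm a" "norm b"] by (simp add: power2_sum)
      finally show ?thesis .
    qed
    then show "AE x in lebesgue_on \<Omega>. norm ((norm (f x + g x))\<^sup>2) \<le> norm (2 * (norm (f x))\<^sup>2 + 2 * (norm (g x))\<^sup>2)"
      by (intro AE_I2) auto
  qed (use m in measurable)
  then show ?thesis using m by (auto simp: L2_def)
qed

lemma L2_scaleR:
  fixes f :: "'a::euclidean_space \<Rightarrow> 'b::euclidean_space"
  assumes "f \<in> L2 \<Omega>"
  shows "(\<lambda>x. c *\<^sub>R f x) \<in> L2 \<Omega>"
  using assms by (auto simp: L2_def power_mult_distrib)

lemma L2_zero: "(\<lambda>x. 0) \<in> L2 \<Omega>"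
  by (simp add: L2_def)

lemma L2_sum:
  fixes f :: "'i \<Rightarrow> 'a::euclidean_space \<Rightarrow> 'b::euclidean_space"
  shows "(\<And>i. i \<in> F \<Longrightarrow> f i \<in> L2 \<Omega>) \<Longrightarrow> (\<lambda>x. \<Sum>i\<in>F. f i x) \<in> L2 \<Omega>"
  by (induction F rule: infinite_finite_induct) (auto intro!: L2_zero L2_add)

lemma L2_mult:
  fixes f :: "'a::euclidean_space \<Rightarrow> real"
  shows "f \<in> L2 \<Omega> \<Longrightarrow> (\<lambda>x. c * f x) \<in> L2 \<Omega>"
  using L2_scaleR[of f \<Omega> c] by simp

lemma L2_component:
  fixes f :: "'a::euclidean_space \<Rightarrow> 'b::euclidean_space"
  assumes "f \<in> L2 \<Omega>" "b \<in> Basis"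
  shows "(\<lambda>x. f x \<bullet> b) \<in> L2 \<Omega>"
proof -
  have m: "f \<in> borel_measurable (lebesgue_on \<Omega>)"
    using assms by (auto simp: L2_def)
  have "integrable (lebesgue_on \<Omega>) (\<lambda>x. (norm (f x \<bullet> b))\<^sup>2)"
  proof (rule Bochner_Integration.integrable_bound)
    show "integrable (lebesgue_on \<Omega>) (\<lambda>x. (norm (f x))\<^sup>2)"
      using assms by (auto simp: L2_def)
    show "AE x in lebesgue_on \<Omega>. norm ((norm (f x \<bullet> b))\<^sup>2) \<le> norm ((norm (f x))\<^sup>2)"
      using Basis_le_norm[OF assms(2)] by (intro AE_I2) (simp flip: abs_le_square_iff)
  qed (use m in measurable)
  then show ?thesis using m by (auto simp: L2_def)
qed

lemma L2_integrable_inner: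
  fixes f g :: "'a::euclidean_space \<Rightarrow> 'b::euclidean_space"
  assumes "f \<in> L2 \<Omega>" "g \<in> L2 \<Omega>"
  shows "integrable (lebesgue_on \<Omega>) (\<lambda>x. f x \<bullet> g x)"
proof (rule Bochner_Integration.integrable_bound)
  show "integrable (lebesgue_on \<Omega>) (\<lambda>x. (norm (f x))\<^sup>2 + (norm (g x))\<^sup>2)"
    using assms by (auto simp: L2_def)
  have "\<bar>a \<bullet> b\<bar> \<le> (norm a)\<^sup>2 + (norm b)\<^sup>2" for a b :: 'b
  proof -
    have "\<bar>a \<bullet> b\<bar> \<le> norm a * norm b" by (rule Cauchy_Schwarz_ineq2)
    also have "\<dots> \<le> (norm a)\<^sup>2 + (norm b)\<^sup>2"
      using sum_squares_bound[of "norm a" "norm b"] mult_nonneg_nonneg[OF norm_ge_zero norm_ge_zero, of a b]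
      unfolding mult.assoc by linarith
    finally show ?thesis .
  qed
  then show "AE x in lebesgue_on \<Omega>. norm (f x \<bullet> g x) \<le> norm ((norm (f x))\<^sup>2 + (norm (g x))\<^sup>2)"
    by (intro AE_I2) auto
qed (use assms in \<open>auto simp: L2_def\<close>)

lemma L2_integrable_mult:
  fixes f g :: "'a::euclidean_space \<Rightarrow> real"
  assumes "f \<in> L2 \<Omega>" "g \<in> L2 \<Omega>"
  shows "integrable (lebesgue_on \<Omega>) (\<lambda>x. f x * g x)"
  using L2_integrable_inner[OF assms] by simp

interpretation L2: function_semi_inner "L2 \<Omega>" "L2_inner \<Omega>" for \<Omega>
proof
  fix u v w :: "'a \<Rightarrow> real" and c :: real
  show "(\<lambda>x. 0::real) \<in> L2 \<Omega>" by (rule L2_zero)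
  show "L2_inner \<Omega> u v = L2_inner \<Omega> v u" by (simp add: L2_inner_def mult.commute)
  assume u: "u \<in> L2 \<Omega>"
  show "(\<lambda>x. c * u x) \<in> L2 \<Omega>" using u by (rule L2_mult)
  show "L2_inner \<Omega> u u \<ge> 0" by (simp add: L2_inner_def)
  { assume w: "w \<in> L2 \<Omega>"
    show "L2_inner \<Omega> (\<lambda>x. c * u x) w = c * L2_inner \<Omega> u w"
      using L2_integrable_mult[OF u w] by (simp add: L2_inner_def mult.assoc) }
  assume v: "v \<in> L2 \<Omega>"
  show "(\<lambda>x. u x + v x) \<in> L2 \<Omega>" using u v by (rule L2_add)
  assume w: "w \<in> L2 \<Omega>"
  show "L2_inner \<Omega> (\<lambda>x. u x + v x) w = L2_inner \<Omega> u w + L2_inner \<Omega> v w"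
    using L2_integrable_mult[OF u w] L2_integrable_mult[OF v w]
    by (simp add: L2_inner_def distrib_right)
qed

lemma L2_inner_self: "L2_inner \<Omega> u u = (LINT x|lebesgue_on \<Omega>. (u x)\<^sup>2)"
  by (simp add: L2_inner_def power2_eq_square)

lemma L2_inner_self_eq_0_imp_AE:
  assumes "u \<in> L2 \<Omega>" "L2_inner \<Omega> u u = 0"
  shows "AE x in lebesgue_on \<Omega>. u x = 0"
proof -
  have "integrable (lebesgue_on \<Omega>) (\<lambda>x. u x * u x)" by (rule L2_integrable_mult[OF assms(1,1)])
  then have "AE x in lebesgue_on \<Omega>. u x * u x = 0"
    using assms(2) unfolding L2_inner_def by (subst (asm) integral_nonneg_eq_0_iff_AE) auto
  then show ?thesis by eventually_elim simp
qed

section \<open>Test functions\<close>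

lemma has_derivative_frechet:
  "f differentiable at x \<Longrightarrow> (f has_derivative frechet_derivative f (at x)) (at x)"
  by (simp add: frechet_derivative_works)

lemma Ck_Suc_imp_Ck: "Ck (Suc k) f \<Longrightarrow> Ck k f"
proof (induction k arbitrary: f)
  case 0
  then show ?case
    by (auto simp: continuous_on_eq_continuous_within intro: differentiable_imp_continuous_within)
next
  case (Suc k)
  then show ?case by (metis Ck.simps(2))
qed

lemma Ck_0: "Ck k (\<lambda>x. 0)"
  by (induction k) auto

lemma Ck_add: "Ck k f \<Longrightarrow> Ck k g \<Longrightarrow> Ck k (\<lambda>x. f x + g x)"
proof (induction k arbitrary: f g)
  case (Suc k)
  have "frechet_derivative (\<lambda>x. f x + g x) (at x) =
      (\<lambda>b. frechet_derivative f (at x) b + frechet_derivative g (at x) b)" for x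
    using Suc.prems
    by (intro frechet_derivative_at[symmetric] has_derivative_add has_derivative_frechet) auto
  with Suc show ?case by auto
qed (auto intro: continuous_on_add)

lemma Ck_cmult: "Ck k f \<Longrightarrow> Ck k (\<lambda>x. c * f x)"
proof (induction k arbitrary: f)
  case (Suc k)
  have "frechet_derivative (\<lambda>x. c * f x) (at x) = (\<lambda>b. c * frechet_derivative f (at x) b)" for x
    using Suc.prems
    by (intro frechet_derivative_at[symmetric] has_derivative_mult_right has_derivative_frechet) auto
  with Suc show ?case by auto
qed (auto intro: continuous_intros)

lemma frechet_derivative_zero_outside_support:
  assumes "x \<notin> closure {x. \<phi> x \<noteq> (0::real)}"
  shows "frechet_derivative \<phi> (at x) b = 0"
proof -
  have 0: "0 = \<phi> y" if "y \<in> - closure {x. \<phi> x \<noteq> 0}" for y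
  proof -
    have "y \<notin> {x. \<phi> x \<noteq> 0}"
      using that closure_subset[of "{x. \<phi> x \<noteq> 0}"] by blast
    then show ?thesis by simp
  qed
  have "(\<phi> has_derivative (\<lambda>b. 0)) (at x)"
  proof (rule has_derivative_transform_within_open[OF has_derivative_const])
    show "open (- closure {x. \<phi> x \<noteq> 0})" by (intro open_Compl closed_closure)
    show "x \<in> - closure {x. \<phi> x \<noteq> 0}" using assms by blast
  qed (rule 0)
  from frechet_derivative_at[OF this] show ?thesis by metis
qed

lemma test_functionsD:
  assumes "\<phi> \<in> test_functions \<Omega>"
  shows "\<phi> differentiable at x" "continuous_on UNIV \<phi>"
    "b \<in> Basis \<Longrightarrow> continuous_on UNIV (\<lambda>x. frechet_derivative \<phi> (at x) b)"
proof -
  have "Ck 0 \<phi>" "Ck (Suc 0) \<phi>" using assms by (auto simp only: test_functions_def mem_Collect_eq)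
  then show "\<phi> differentiable at x" "continuous_on UNIV \<phi>"
    "b \<in> Basis \<Longrightarrow> continuous_on UNIV (\<lambda>x. frechet_derivative \<phi> (at x) b)"
    by auto
qed

lemma test_functions_derivative:
  assumes "\<phi> \<in> test_functions \<Omega>" "b \<in> Basis"
  shows "(\<lambda>x. frechet_derivative \<phi> (at x) b) \<in> test_functions \<Omega>"
proof -
  let ?K = "closure {x. \<phi> x \<noteq> 0}"
  have "{x. frechet_derivative \<phi> (at x) b \<noteq> 0} \<subseteq> ?K"
    using frechet_derivative_zero_outside_support by blast
  then have sub: "closure {x. frechet_derivative \<phi> (at x) b \<noteq> 0} \<subseteq> ?K"
    by (simp add: closure_minimal)
  have K: "compact ?K" "?K \<subseteq> \<Omega>" using assms by (auto simp: test_functions_def)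
  have "Ck k (\<lambda>x. frechet_derivative \<phi> (at x) b)" for k
  proof -
    have "Ck (Suc k) \<phi>" using assms(1) by (simp only: test_functions_def mem_Collect_eq)
    then show ?thesis using assms(2) by simp
  qed
  moreover have "compact (closure {x. frechet_derivative \<phi> (at x) b \<noteq> 0})"
    using compact_Int_closed[OF K(1) closed_closure[of "{x. frechet_derivative \<phi> (at x) b \<noteq> 0}"]] sub
    by (simp add: Int_absorb1)
  ultimately show ?thesis
    using sub K(2) by (auto simp: test_functions_def)
qed

lemma test_functionsI:
  assumes "\<And>k. Ck k \<phi>" "compact K" "K \<subseteq> \<Omega>" "\<And>x. x \<notin> K \<Longrightarrow> \<phi> x = 0"
  shows "\<phi> \<in> test_functions \<Omega>"
proof -
  have "closure {x. \<phi> x \<noteq> 0} \<subseteq> K"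
    using assms by (intro closure_minimal compact_imp_closed) auto
  moreover from this have "compact (closure {x. \<phi> x \<noteq> 0})"
    using compact_Int_closed[OF assms(2) closed_closure[of "{x. \<phi> x \<noteq> 0}"]]
    by (simp add: Int_absorb1)
  ultimately show ?thesis using assms by (auto simp: test_functions_def)
qed

lemma test_functionsE:
  assumes "\<phi> \<in> test_functions \<Omega>"
  obtains K where "compact K" "K \<subseteq> \<Omega>" "\<And>x. x \<notin> K \<Longrightarrow> \<phi> x = 0"
    "\<And>x b. x \<notin> K \<Longrightarrow> frechet_derivative \<phi> (at x) b = 0"
proof (rule that)
  let ?K = "closure {x. \<phi> x \<noteq> 0}"
  show "compact ?K" "?K \<subseteq> \<Omega>" using assms by (auto simp: test_functions_def)
  show "x \<notin> ?K \<Longrightarrow> \<phi> x = 0" for x using closure_subset[of "{x. \<phi> x \<noteq> 0}"] by auto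
  show "x \<notin> ?K \<Longrightarrow> frechet_derivative \<phi> (at x) b = 0" for x b
    by (rule frechet_derivative_zero_outside_support)
qed

lemma test_functions_zero: "(\<lambda>x. 0) \<in> test_functions \<Omega>"
  by (rule test_functionsI[of _ "{}"]) (auto simp: Ck_0)

lemma test_functions_add:
  assumes "\<phi> \<in> test_functions \<Omega>" "\<psi> \<in> test_functions \<Omega>"
  shows "(\<lambda>x. \<phi> x + \<psi> x) \<in> test_functions \<Omega>"
proof -
  obtain K where K: "compact K" "K \<subseteq> \<Omega>" "\<And>x. x \<notin> K \<Longrightarrow> \<phi> x = 0"
    using test_functionsE[OF assms(1)] by metis
  obtain L where L: "compact L" "L \<subseteq> \<Omega>" "\<And>x. x \<notin> L \<Longrightarrow> \<psi> x = 0"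
    using test_functionsE[OF assms(2)] by metis
  show ?thesis
    using assms K L
    by (intro test_functionsI[of _ "K \<union> L"]) (auto simp: test_functions_def intro: Ck_add)
qed

lemma test_functions_cmult:
  assumes "\<phi> \<in> test_functions \<Omega>"
  shows "(\<lambda>x. c * \<phi> x) \<in> test_functions \<Omega>"
proof -
  obtain K where K: "compact K" "K \<subseteq> \<Omega>" "\<And>x. x \<notin> K \<Longrightarrow> \<phi> x = 0"
    using test_functionsE[OF assms(1)] by metis
  show ?thesis
    using assms K
    by (intro test_functionsI[of _ K]) (auto simp: test_functions_def intro: Ck_cmult)
qed

lemma compact_support_integral:
  fixes F :: "'a::euclidean_space \<Rightarrow> real"
  assumes F: "continuous_on UNIV F" and K: "compact K" "K \<subseteq> \<Omega>" "\<And>x. x \<notin> K \<Longrightarrow> F x = 0"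
    and \<Omega>: "open \<Omega>"
  shows "integrable lborel F" "integrable (lebesgue_on \<Omega>) F"
    "(LINT x|lebesgue_on \<Omega>. F x) = (LINT x|lborel. F x)"
proof -
  have m: "F \<in> borel_measurable borel" by (rule borel_measurable_continuous_onI[OF F])
  have "integrable lborel (\<lambda>x. indicator K x *\<^sub>R F x)"
    by (rule borel_integrable_compact[OF K(1) continuous_on_subset[OF F]]) auto
  moreover have "indicator K x *\<^sub>R F x = F x" for x using K by (auto simp: indicator_def)
  ultimately show i: "integrable lborel F" by (simp only:)
  have eq: "indicator \<Omega> x * F x = F x" for x using K by (auto simp: indicator_def)
  show "integrable (lebesgue_on \<Omega>) F"
    using \<Omega> i m by (simp add: integrable_restrict_space eq integrable_completion)
  show "(LINT x|lebesgue_on \<Omega>. F x) = (LINT x|lborel. F x)"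
    using \<Omega> m by (simp add: integral_restrict_space eq integral_completion)
qed

lemma test_functions_L2:
  assumes "open \<Omega>" "\<phi> \<in> test_functions \<Omega>"
  shows "\<phi> \<in> L2 \<Omega>"
proof -
  obtain K where K: "compact K" "K \<subseteq> \<Omega>" "\<And>x. x \<notin> K \<Longrightarrow> \<phi> x = 0"
    using test_functionsE[OF assms(2)] by metis
  have c: "continuous_on UNIV \<phi>" using assms test_functionsD by blast
  have "integrable (lebesgue_on \<Omega>) (\<lambda>x. (\<phi> x)\<^sup>2)"
    by (rule compact_support_integral(2)[OF _ K(1,2) _ assms(1)]) (auto intro: continuous_intros c K(3))
  moreover have "\<phi> \<in> borel_measurable (lebesgue_on \<Omega>)"
    by (rule compact_support_integral(2)[OF c K assms(1), THEN borel_measurable_integrable])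
  ultimately show ?thesis by (simp add: L2_def)
qed

section \<open>Classical gradients are weak gradients\<close>

text \<open>
  The integral of the difference quotient \<open>(F (x + t b) - F x) / t\<close> vanishes by translation
  invariance, and the quotients converge boundedly to the directional derivative as \<open>t\<close> tends to \<open>0\<close>.
\<close>

lemma integral_directional_derivative_eq_0:
  fixes F D :: "'a::euclidean_space \<Rightarrow> real"
  assumes der: "\<And>x. ((\<lambda>t. F (x + t *\<^sub>R b)) has_real_derivative D x) (at 0)"
    and cF: "continuous_on UNIV F" and cD: "continuous_on UNIV D"
    and K: "compact K" "\<And>x. x \<notin> K \<Longrightarrow> F x = 0" "\<And>x. x \<notin> K \<Longrightarrow> D x = 0"
  shows "(LINT x|lborel. D x) = 0"
proof -
  define t where "t n = 1 / real (Suc n)" for n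
  define q where "q n x = (F (x + t n *\<^sub>R b) - F x) / t n" for n x
  have t: "0 < t n" "t n \<le> 1" for n by (auto simp: t_def)
  have mF: "F \<in> borel_measurable borel" "D \<in> borel_measurable borel"
    using cF cD by (auto intro: borel_measurable_continuous_onI)
  have iF: "integrable lborel F"
    using compact_support_integral(1)[OF cF K(1) _ K(2), of UNIV] by simp
  have shift: "integrable lborel (\<lambda>x. F (x + c))" "(LINT x|lborel. F (x + c)) = (LINT x|lborel. F x)" for c
  proof -
    have d: "distr lborel borel ((+) c) = (lborel :: 'a measure)" by (rule lborel_distr_plus)
    have "integrable (distr lborel borel ((+) c)) F" unfolding d by (rule iF)
    then show "integrable lborel (\<lambda>x. F (x + c))"
      using mF by (subst (asm) integrable_distr_eq) (auto simp: add.commute)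
    have "(LINT x|distr lborel borel ((+) c). F x) = (LINT x|lborel. F (x + c))"
      using mF by (subst integral_distr) (auto simp: add.commute)
    then show "(LINT x|lborel. F (x + c)) = (LINT x|lborel. F x)" unfolding d by simp
  qed
  have q0: "(LINT x|lborel. q n x) = 0" for n
    unfolding q_def using shift iF by (simp add: diff_divide_distrib)
  obtain B where B: "\<And>x. x \<in> K \<Longrightarrow> norm x \<le> B"
    using compact_imp_bounded[OF K(1)] by (auto simp: bounded_iff)
  obtain M where M: "M \<ge> 0" "\<And>x. \<bar>D x\<bar> \<le> M"
  proof -
    have "bounded (D ` K)"
      using K(1) cD by (intro compact_imp_bounded compact_continuous_image continuous_on_subset[OF cD]) auto
    then obtain M where "\<And>x. x \<in> K \<Longrightarrow> \<bar>D x\<bar> \<le> M" by (auto simp: bounded_iff)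
    then have "\<bar>D x\<bar> \<le> max M 0" for x using K(3)[of x] by (cases "x \<in> K") (auto simp: le_max_iff_disj)
    then show ?thesis using that[of "max M 0"] by auto
  qed
  have der': "((\<lambda>s. F (x + s *\<^sub>R b)) has_real_derivative D (x + s *\<^sub>R b)) (at s)" for x s
    using DERIV_shift[of "\<lambda>r. F (x + r *\<^sub>R b)" "D (x + s *\<^sub>R b)" 0 s] der[of "x + s *\<^sub>R b"]
    by (simp add: algebra_simps)
  have qM: "\<bar>q n x\<bar> \<le> M" for n x
  proof -
    have "\<exists>z>0. z < t n \<and> F (x + t n *\<^sub>R b) - F (x + 0 *\<^sub>R b) = (t n - 0) * D (x + z *\<^sub>R b)"
      by (rule MVT2[OF t(1)]) (rule der')
    then obtain z where "F (x + t n *\<^sub>R b) - F (x + 0 *\<^sub>R b) = (t n - 0) * D (x + z *\<^sub>R b)" by blast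
    then have "q n x = D (x + z *\<^sub>R b)" using t(1)[of n] by (simp add: q_def)
    with M(2) show ?thesis by simp
  qed
  \<comment> \<open>As \<open>t n \<le> 1\<close>, all difference quotients vanish outside one ball; its multiple by \<open>M\<close> dominates.\<close>
  define R where "R = B + norm b"
  have q_supp: "q n x = 0" if "x \<notin> cball 0 R" for n x
  proof -
    have nx: "norm x > B + norm b" using that by (simp add: R_def)
    have "norm x \<le> norm (x + t n *\<^sub>R b) + norm (t n *\<^sub>R b)"
      using norm_triangle_ineq4[of "x + t n *\<^sub>R b" "t n *\<^sub>R b"] by simp
    moreover have "norm (t n *\<^sub>R b) \<le> norm b"
      using t[of n] mult_right_mono[of "t n" 1 "norm b"] by simp
    ultimately have "norm (x + t n *\<^sub>R b) > B" using nx by linarith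
    moreover have "norm x > B" using nx norm_ge_zero[of b] by linarith
    ultimately have "x \<notin> K" "x + t n *\<^sub>R b \<notin> K" using B by force+
    then show ?thesis by (simp add: q_def K(2))
  qed
  have bound: "norm (q n x) \<le> M * indicator (cball 0 R) x" for n x
    using qM[of n x] q_supp[of x n] M(1) by (auto simp: indicator_def)
  have lim: "(\<lambda>n. q n x) \<longlonglongrightarrow> D x" for x
  proof -
    have "((\<lambda>h. (F (x + h *\<^sub>R b) - F x) / h) \<longlongrightarrow> D x) (at 0)"
      using der[of x] by (simp add: DERIV_def)
    moreover have "t \<longlonglongrightarrow> 0"
      using LIMSEQ_inverse_real_of_nat unfolding t_def[abs_def] inverse_eq_divide .
    then have "filterlim t (at 0) sequentially"
      using t(1) by (simp add: filterlim_at less_imp_neq[symmetric])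
    ultimately show ?thesis
      unfolding q_def by (rule filterlim_compose)
  qed
  have "(\<lambda>n. LINT x|lborel. q n x) \<longlonglongrightarrow> (LINT x|lborel. D x)"
  proof (rule integral_dominated_convergence[where w="\<lambda>x. M * indicator (cball 0 R) x"])
    show "q n \<in> borel_measurable lborel" for n
      unfolding q_def using mF by measurable
    show "integrable lborel (\<lambda>x. M * indicator (cball (0::'a) R) x)"
      by (intro integrable_mult_right integrable_real_indicator) (use emeasure_bounded_finite[OF bounded_cball, of "0::'a" R] in auto)
  qed (use mF lim bound in auto)
  then show ?thesis using q0 by (simp add: LIMSEQ_const_iff)
qed

definition classical_grad :: "('a::euclidean_space \<Rightarrow> real) \<Rightarrow> 'a \<Rightarrow> 'a" where
  "classical_grad \<phi> x = (\<Sum>b\<in>Basis. frechet_derivative \<phi> (at x) b *\<^sub>R b)"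

lemma classical_grad_inner_Basis:
  "b \<in> Basis \<Longrightarrow> classical_grad \<phi> x \<bullet> b = frechet_derivative \<phi> (at x) b"
  by (simp add: classical_grad_def)

lemma classical_grad_L2:
  assumes "open \<Omega>" "\<phi> \<in> test_functions \<Omega>"
  shows "classical_grad \<phi> \<in> L2 \<Omega>"
proof -
  have "(\<lambda>x. \<Sum>b\<in>Basis. frechet_derivative \<phi> (at x) b *\<^sub>R b) \<in> L2 \<Omega>"
  proof (rule L2_sum)
    fix b :: 'a assume b: "b \<in> Basis"
    have "(\<lambda>x. frechet_derivative \<phi> (at x) b) \<in> L2 \<Omega>"
      using test_functions_L2[OF assms(1) test_functions_derivative[OF assms(2) b]] .
    with b show "(\<lambda>x. frechet_derivative \<phi> (at x) b *\<^sub>R b) \<in> L2 \<Omega>"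
      by (auto simp: L2_def power_mult_distrib)
  qed
  then show ?thesis by (simp add: classical_grad_def[abs_def])
qed

text \<open>
  Apply the vanishing of the integral of a directional derivative to the product \<open>\<phi> \<psi>\<close>.
\<close>
lemma has_weak_gradient_classical_grad:
  assumes \<Omega>: "open \<Omega>" and \<phi>: "\<phi> \<in> test_functions \<Omega>"
  shows "has_weak_gradient \<Omega> \<phi> (classical_grad \<phi>)"
  unfolding has_weak_gradient_def
proof (intro conjI ballI)
  show "classical_grad \<phi> \<in> L2 \<Omega>" using assms by (rule classical_grad_L2)
  fix \<psi> b assume \<psi>: "\<psi> \<in> test_functions \<Omega>" and b: "b \<in> (Basis :: 'a set)"
  let ?D = "\<lambda>f x. frechet_derivative f (at x) b"
  obtain K where K: "compact K" "K \<subseteq> \<Omega>" "\<And>x. x \<notin> K \<Longrightarrow> \<phi> x = 0" "\<And>x b. x \<notin> K \<Longrightarrow> frechet_derivative \<phi> (at x) b = 0"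
    using test_functionsE[OF \<phi>] by metis
  note c = test_functionsD[OF \<phi>] test_functionsD[OF \<psi>]
  have cD: "continuous_on UNIV (?D \<phi>)" "continuous_on UNIV (?D \<psi>)" using c b by auto
  let ?F = "\<lambda>x. \<phi> x * \<psi> x" and ?G = "\<lambda>x. \<phi> x * ?D \<psi> x + ?D \<phi> x * \<psi> x"
  have line: "((\<lambda>t. f (x + t *\<^sub>R b)) has_real_derivative ?D f x) (at 0)"
    if "f differentiable at x" for f :: "'a \<Rightarrow> real" and x
  proof -
    have 1: "((\<lambda>t::real. x + t *\<^sub>R b) has_derivative (\<lambda>t. t *\<^sub>R b)) (at 0)"
      by (auto intro!: derivative_eq_intros)
    have 2: "(f has_derivative frechet_derivative f (at x)) (at (x + 0 *\<^sub>R b))"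
      using has_derivative_frechet[OF that] by simp
    have "((\<lambda>t. f (x + t *\<^sub>R b)) has_derivative (\<lambda>t. frechet_derivative f (at x) (t *\<^sub>R b))) (at 0)"
      using has_derivative_compose[OF 1 2] by simp
    moreover have "(\<lambda>t. frechet_derivative f (at x) (t *\<^sub>R b)) = (*) (?D f x)"
      using linear_frechet_derivative[OF that] by (auto simp: linear_scale)
    ultimately show ?thesis by (simp add: has_field_derivative_def)
  qed
  have "(LINT x|lborel. ?G x) = 0"
  proof (rule integral_directional_derivative_eq_0[where F="?F" and b=b and K=K])
    show "((\<lambda>t. \<phi> (x + t *\<^sub>R b) * \<psi> (x + t *\<^sub>R b)) has_real_derivative ?G x) (at 0)" for x
      using DERIV_mult[OF line line, of \<phi> x \<psi> x] c by (simp add: algebra_simps)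
    show "continuous_on UNIV ?F" "continuous_on UNIV ?G"
      using c cD by (auto intro!: continuous_intros)
  qed (use K in auto)
  moreover have "integrable lborel (\<lambda>x. \<phi> x * ?D \<psi> x)" "integrable lborel (\<lambda>x. ?D \<phi> x * \<psi> x)"
    "(LINT x|lebesgue_on \<Omega>. \<phi> x * ?D \<psi> x) = (LINT x|lborel. \<phi> x * ?D \<psi> x)"
    "(LINT x|lebesgue_on \<Omega>. ?D \<phi> x * \<psi> x) = (LINT x|lborel. ?D \<phi> x * \<psi> x)"
    by (rule compact_support_integral[where K=K and \<Omega>=\<Omega>]; use K \<Omega> c cD in \<open>auto intro!: continuous_intros\<close>)+
  ultimately show "(LINT x|lebesgue_on \<Omega>. \<phi> x * ?D \<psi> x) =
        - (LINT x|lebesgue_on \<Omega>. (classical_grad \<phi> x \<bullet> b) * \<psi> x)"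
    by (simp add: classical_grad_inner_Basis[OF b])
qed

section \<open>Weak gradients when the test functions are dense\<close>

text \<open>
  The weak gradient is chosen arbitrarily among all candidates, so nothing can be computed with
  \<open>grad_inner\<close> before candidates are known to agree almost everywhere. This follows from density of
  the test functions in \<open>L\<^sup>2(\<Omega>)\<close>. For the domains considered here the density is inherited from a
  basis of eigenfunctions, each of which is a limit of test functions, so it is carried as a
  hypothesis until that point.
\<close>

abbreviation test_functions_dense :: "'a::euclidean_space set \<Rightarrow> bool" where
  "test_functions_dense \<Omega> \<equiv> \<forall>v\<in>(L2 \<Omega> :: ('a \<Rightarrow> real) set). L2.approximable \<Omega> (test_functions \<Omega>) v"

text \<open>
  Each component \<open>w\<close> of the difference is orthogonal to all test functions. For such \<open>w\<close> the squared
  distance to a test function \<open>\<phi>\<close> is \<open>\<parallel>w\<parallel>\<^sup>2 + \<parallel>\<phi>\<parallel>\<^sup>2\<close>, so it is at least \<open>\<parallel>w\<parallel>\<^sup>2\<close>, while density makes it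
  arbitrarily small.
\<close>
lemma has_weak_gradient_unique:
  assumes \<Omega>: "open \<Omega>" and dense: "test_functions_dense \<Omega>"
    and g: "has_weak_gradient \<Omega> u g" and h: "has_weak_gradient \<Omega> u h"
  shows "AE x in lebesgue_on \<Omega>. g x = h x"
proof -
  have gh: "g \<in> L2 \<Omega>" "h \<in> L2 \<Omega>" using g h by (auto simp: has_weak_gradient_def)
  have "AE x in lebesgue_on \<Omega>. g x \<bullet> b - h x \<bullet> b = 0" if b: "b \<in> Basis" for b
  proof (rule L2_inner_self_eq_0_imp_AE)
    let ?w = "\<lambda>x. g x \<bullet> b - h x \<bullet> b"
    have c: "(\<lambda>x. g x \<bullet> b) \<in> L2 \<Omega>" "(\<lambda>x. h x \<bullet> b) \<in> L2 \<Omega>"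
      using gh b by (auto intro: L2_component)
    then show w: "?w \<in> L2 \<Omega>" by (rule L2.diff_mem)
    have orth: "L2_inner \<Omega> ?w \<phi> = 0" if \<phi>: "\<phi> \<in> test_functions \<Omega>" for \<phi>
    proof -
      have "L2_inner \<Omega> (\<lambda>x. g x \<bullet> b) \<phi> = L2_inner \<Omega> (\<lambda>x. h x \<bullet> b) \<phi>"
        using g h \<phi> b unfolding has_weak_gradient_def L2_inner_def by fastforce
      then show ?thesis
        using L2.ip_diff[OF c test_functions_L2[OF \<Omega> \<phi>]] by simp
    qed
    have "L2_inner \<Omega> ?w ?w \<le> 0"
    proof (rule field_le_epsilon)
      fix \<epsilon> :: real assume "\<epsilon> > 0"
      then obtain \<phi> where \<phi>: "\<phi> \<in> test_functions \<Omega>"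
        "L2_inner \<Omega> (\<lambda>x. ?w x - \<phi> x) (\<lambda>x. ?w x - \<phi> x) < \<epsilon>"
        using bspec[OF dense w] unfolding L2.approximable_def by meson
      have t: "\<phi> \<in> L2 \<Omega>" by (rule test_functions_L2[OF \<Omega> \<phi>(1)])
      show "L2_inner \<Omega> ?w ?w \<le> 0 + \<epsilon>"
        using \<phi>(2) L2.ip_nonneg[OF t] by (simp add: L2.ip_diff_self[OF w t] orth[OF \<phi>(1)])
    qed
    with L2.ip_nonneg[OF w] show "L2_inner \<Omega> ?w ?w = 0" by linarith
  qed
  then have "AE x in lebesgue_on \<Omega>. \<forall>b\<in>Basis. g x \<bullet> b - h x \<bullet> b = 0"
    by (intro AE_finite_allI) auto
  then show ?thesis
    by eventually_elim (auto intro: euclidean_eqI)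
qed

lemma has_weak_gradient_weak_grad:
  "u \<in> H1 \<Omega> \<Longrightarrow> has_weak_gradient \<Omega> u (weak_grad \<Omega> u)"
  unfolding H1_def weak_grad_def mem_Collect_eq by (elim conjE someI_ex)

text \<open>
  Replaces the chosen representatives by explicit ones; every computation of a gradient product
  passes through this.
\<close>
lemma grad_inner_eq:
  assumes "open \<Omega>" "test_functions_dense \<Omega>" and u: "has_weak_gradient \<Omega> u g" and v: "has_weak_gradient \<Omega> v h"
  shows "grad_inner \<Omega> u v = (LINT x|lebesgue_on \<Omega>. g x \<bullet> h x)"
proof -
  have u': "has_weak_gradient \<Omega> u (weak_grad \<Omega> u)" and v': "has_weak_gradient \<Omega> v (weak_grad \<Omega> v)"
    unfolding weak_grad_def by (rule someI[of "has_weak_gradient \<Omega> u", OF u], rule someI[of "has_weak_gradient \<Omega> v", OF v])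
  have m: "g \<in> borel_measurable (lebesgue_on \<Omega>)" "h \<in> borel_measurable (lebesgue_on \<Omega>)"
    "weak_grad \<Omega> u \<in> borel_measurable (lebesgue_on \<Omega>)" "weak_grad \<Omega> v \<in> borel_measurable (lebesgue_on \<Omega>)"
    using u v u' v' by (auto simp: has_weak_gradient_def L2_def)
  show ?thesis
    unfolding grad_inner_def
  proof (rule integral_cong_AE)
    show "AE x in lebesgue_on \<Omega>. weak_grad \<Omega> u x \<bullet> weak_grad \<Omega> v x = g x \<bullet> h x"
      using has_weak_gradient_unique[OF assms(1,2) u' u] has_weak_gradient_unique[OF assms(1,2) v' v]
      by eventually_elim simp
  qed (use m in measurable)
qed

lemma has_weak_gradient_add:
  assumes \<Omega>: "open \<Omega>" and uv: "u \<in> L2 \<Omega>" "v \<in> L2 \<Omega>"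
    and g: "has_weak_gradient \<Omega> u g" and h: "has_weak_gradient \<Omega> v h"
  shows "has_weak_gradient \<Omega> (\<lambda>x. u x + v x) (\<lambda>x. g x + h x)"
  unfolding has_weak_gradient_def
proof (intro conjI ballI)
  have gh: "g \<in> L2 \<Omega>" "h \<in> L2 \<Omega>" using g h by (auto simp: has_weak_gradient_def)
  then show "(\<lambda>x. g x + h x) \<in> L2 \<Omega>" by (rule L2_add)
  fix \<phi> b assume \<phi>: "\<phi> \<in> test_functions \<Omega>" and b: "b \<in> (Basis :: 'a set)"
  let ?D = "\<lambda>x. frechet_derivative \<phi> (at x) b"
  have t: "\<phi> \<in> L2 \<Omega>" "?D \<in> L2 \<Omega>"
    using \<phi> b \<Omega> by (auto intro: test_functions_L2 test_functions_derivative)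
  have "(LINT x|lebesgue_on \<Omega>. (u x + v x) * ?D x) =
      (LINT x|lebesgue_on \<Omega>. u x * ?D x) + (LINT x|lebesgue_on \<Omega>. v x * ?D x)"
    using L2_integrable_mult[OF uv(1) t(2)] L2_integrable_mult[OF uv(2) t(2)] by (simp add: distrib_right)
  also have "\<dots> = - ((LINT x|lebesgue_on \<Omega>. (g x \<bullet> b) * \<phi> x) + (LINT x|lebesgue_on \<Omega>. (h x \<bullet> b) * \<phi> x))"
    using g h \<phi> b unfolding has_weak_gradient_def by auto
  also have "\<dots> = - (LINT x|lebesgue_on \<Omega>. ((g x + h x) \<bullet> b) * \<phi> x)"
    using L2_integrable_mult[OF L2_component[OF gh(1) b] t(1)]
      L2_integrable_mult[OF L2_component[OF gh(2) b] t(1)]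
    by (simp add: inner_add_left distrib_right)
  finally show "(LINT x|lebesgue_on \<Omega>. (u x + v x) * ?D x) =
      - (LINT x|lebesgue_on \<Omega>. ((g x + h x) \<bullet> b) * \<phi> x)" .
qed

lemma has_weak_gradient_cmult:
  assumes g: "has_weak_gradient \<Omega> u g"
  shows "has_weak_gradient \<Omega> (\<lambda>x. c * u x) (\<lambda>x. c *\<^sub>R g x)"
  using g unfolding has_weak_gradient_def by (auto simp: L2_scaleR mult.assoc)

lemma H1I: "u \<in> L2 \<Omega> \<Longrightarrow> has_weak_gradient \<Omega> u g \<Longrightarrow> u \<in> H1 \<Omega>"
  by (auto simp: H1_def)

lemma H1_imp_L2: "u \<in> H1 \<Omega> \<Longrightarrow> u \<in> L2 \<Omega>"
  by (simp add: H1_def)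

lemma test_functions_H1: "open \<Omega> \<Longrightarrow> test_functions \<Omega> \<subseteq> H1 \<Omega>"
  by (auto intro: H1I test_functions_L2 has_weak_gradient_classical_grad)

lemma grad_inner_self_nonneg: "grad_inner \<Omega> u u \<ge> 0"
  by (simp add: grad_inner_def)

definition H1_inner :: "'a::euclidean_space set \<Rightarrow> ('a \<Rightarrow> real) \<Rightarrow> ('a \<Rightarrow> real) \<Rightarrow> real" where
  "H1_inner \<Omega> u v = L2_inner \<Omega> u v + grad_inner \<Omega> u v"

lemma H1_inner_products:
  assumes \<Omega>: "open \<Omega>" and dense: "test_functions_dense \<Omega>"
  shows "function_semi_inner (H1 \<Omega>) (grad_inner \<Omega>)" "function_semi_inner (H1 \<Omega>) (H1_inner \<Omega>)"
proof -
  note w = has_weak_gradient_weak_grad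
  have zero: "(\<lambda>x. 0) \<in> H1 \<Omega>"
    using test_functions_zero test_functions_H1[OF \<Omega>] by blast
  have add: "(\<lambda>x. u x + v x) \<in> H1 \<Omega>" if "u \<in> H1 \<Omega>" "v \<in> H1 \<Omega>" for u v
    by (rule H1I[OF L2_add[OF H1_imp_L2[OF that(1)] H1_imp_L2[OF that(2)]]
          has_weak_gradient_add[OF \<Omega> H1_imp_L2[OF that(1)] H1_imp_L2[OF that(2)] w[OF that(1)] w[OF that(2)]]])
  have scale: "(\<lambda>x. c * u x) \<in> H1 \<Omega>" if "u \<in> H1 \<Omega>" for u c
    by (rule H1I[OF L2_mult[OF H1_imp_L2[OF that]] has_weak_gradient_cmult[OF w[OF that]]])
  have i: "integrable (lebesgue_on \<Omega>) (\<lambda>x. weak_grad \<Omega> u x \<bullet> weak_grad \<Omega> v x)"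
    if "u \<in> H1 \<Omega>" "v \<in> H1 \<Omega>" for u v
    using w[OF that(1)] w[OF that(2)] by (intro L2_integrable_inner) (auto simp: has_weak_gradient_def)
  have comm: "grad_inner \<Omega> u v = grad_inner \<Omega> v u" for u v
    by (simp add: grad_inner_def inner_commute)
  have g_add: "grad_inner \<Omega> (\<lambda>x. u x + v x) z = grad_inner \<Omega> u z + grad_inner \<Omega> v z"
    if "u \<in> H1 \<Omega>" "v \<in> H1 \<Omega>" "z \<in> H1 \<Omega>" for u v z
    using has_weak_gradient_add[OF \<Omega> H1_imp_L2[OF that(1)] H1_imp_L2[OF that(2)] w[OF that(1)] w[OF that(2)]]
    by (subst grad_inner_eq[OF \<Omega> dense _ w[OF that(3)]], assumption)
       (use i that in \<open>simp add: grad_inner_def inner_add_left\<close>)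
  have g_scale: "grad_inner \<Omega> (\<lambda>x. c * u x) z = c * grad_inner \<Omega> u z"
    if "u \<in> H1 \<Omega>" "z \<in> H1 \<Omega>" for u z c
    by (subst grad_inner_eq[OF \<Omega> dense has_weak_gradient_cmult[OF w[OF that(1)]] w[OF that(2)]])
       (simp add: grad_inner_def)
  show "function_semi_inner (H1 \<Omega>) (grad_inner \<Omega>)"
    by unfold_locales (use zero add scale g_add g_scale comm grad_inner_self_nonneg in auto)
  show "function_semi_inner (H1 \<Omega>) (H1_inner \<Omega>)"
    unfolding H1_inner_def
  proof
    fix u v :: "'a \<Rightarrow> real"
    show "L2_inner \<Omega> u v + grad_inner \<Omega> u v = L2_inner \<Omega> v u + grad_inner \<Omega> v u"
      using L2.ip_commute[of \<Omega> u v] comm[of u v] by simp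
    show "L2_inner \<Omega> u u + grad_inner \<Omega> u u \<ge> 0" if "u \<in> H1 \<Omega>"
      by (intro add_nonneg_nonneg L2.ip_nonneg grad_inner_self_nonneg H1_imp_L2 that)
  qed (use zero add scale in \<open>simp_all add: g_add g_scale L2.ip_add L2.ip_scale H1_imp_L2 distrib_left\<close>)
qed

lemma H01_subset_H1: "H01 \<Omega> \<subseteq> H1 \<Omega>"
  by (auto simp: H01_def)

lemma H01_approximation:
  assumes "u \<in> H01 \<Omega>" "\<epsilon> > 0"
  obtains \<phi> where "\<phi> \<in> test_functions \<Omega>" "H1_inner \<Omega> (\<lambda>x. u x - \<phi> x) (\<lambda>x. u x - \<phi> x) < \<epsilon>"
proof -
  have "sqrt \<epsilon> > 0" using assms by simp
  then obtain \<phi> where "\<phi> \<in> test_functions \<Omega>" "H1_norm \<Omega> (\<lambda>x. u x - \<phi> x) < sqrt \<epsilon>"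
    using assms(1) unfolding H01_def by blast
  then show ?thesis by (intro that[of \<phi>]) (auto simp: H1_norm_def H1_inner_def)
qed

text \<open>
  Density in \<open>L\<^sup>2\<close> is what uniqueness of weak gradients rests on, so the representative occurring in the
  \<open>H\<^sup>1\<close> norm is arbitrary here. The bound holds because its contribution is nonnegative in any case.
\<close>
lemma H01_L2_approximable:
  assumes "u \<in> H01 \<Omega>"
  shows "L2.approximable \<Omega> (test_functions \<Omega>) u"
  unfolding L2.approximable_def
proof (intro allI impI)
  fix \<epsilon> :: real assume "\<epsilon> > 0"
  then obtain \<phi> where \<phi>: "\<phi> \<in> test_functions \<Omega>" "H1_inner \<Omega> (\<lambda>x. u x - \<phi> x) (\<lambda>x. u x - \<phi> x) < \<epsilon>"
    using H01_approximation[OF assms] by blast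
  have "L2_inner \<Omega> (\<lambda>x. u x - \<phi> x) (\<lambda>x. u x - \<phi> x) < \<epsilon>"
    using \<phi>(2) grad_inner_self_nonneg[of \<Omega> "\<lambda>x. u x - \<phi> x"] by (simp add: H1_inner_def)
  with \<phi>(1) show "\<exists>\<phi>\<in>test_functions \<Omega>. L2_inner \<Omega> (\<lambda>x. u x - \<phi> x) (\<lambda>x. u x - \<phi> x) < \<epsilon>"
    by (intro bexI)
qed

lemma test_functions_denseI:
  fixes \<Omega> :: "'a::euclidean_space set"
  assumes \<Omega>: "open \<Omega>" and b: "orthonormal_basis (L2 \<Omega>) (L2_inner \<Omega>) e"
    and e: "\<And>i. L2.approximable \<Omega> (test_functions \<Omega>) (e i)"
  shows "test_functions_dense \<Omega>"
proof
  fix v :: "'a \<Rightarrow> real" assume v: "v \<in> L2 \<Omega>"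
  show "L2.approximable \<Omega> (test_functions \<Omega>) v"
    by (rule L2.orthonormal_basis_imp_approximable[OF b order_refl _ test_functions_zero
          test_functions_add test_functions_cmult e v])
       (auto intro: test_functions_L2 \<Omega>)
qed

lemma H01_iff:
  assumes \<Omega>: "open \<Omega>" and dense: "test_functions_dense \<Omega>"
  shows "u \<in> H01 \<Omega> \<longleftrightarrow> u \<in> H1 \<Omega> \<and> function_semi_inner.approximable (H1_inner \<Omega>) (test_functions \<Omega>) u"
proof -
  interpret H1: function_semi_inner "H1 \<Omega>" "H1_inner \<Omega>" by (rule H1_inner_products[OF \<Omega> dense])
  have eq: "H1_norm \<Omega> v < \<epsilon> \<longleftrightarrow> H1_inner \<Omega> v v < \<epsilon>\<^sup>2" if "\<epsilon> > 0" for v \<epsilon>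
  proof -
    have "sqrt (H1_inner \<Omega> v v) < sqrt (\<epsilon>\<^sup>2) \<longleftrightarrow> H1_inner \<Omega> v v < \<epsilon>\<^sup>2" by (rule real_sqrt_less_iff)
    then show ?thesis using that by (simp add: H1_norm_def H1_inner_def)
  qed
  show ?thesis
  proof
    assume u: "u \<in> H01 \<Omega>"
    have "\<exists>\<phi>\<in>test_functions \<Omega>. H1_inner \<Omega> (\<lambda>x. u x - \<phi> x) (\<lambda>x. u x - \<phi> x) < \<epsilon>" if "\<epsilon> > 0" for \<epsilon>
      using H01_approximation[OF u that] by metis
    then show "u \<in> H1 \<Omega> \<and> H1.approximable (test_functions \<Omega>) u"
      using subsetD[OF H01_subset_H1 u] unfolding H1.approximable_def by (intro conjI allI impI)
  next
    assume u: "u \<in> H1 \<Omega> \<and> H1.approximable (test_functions \<Omega>) u"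
    have "\<exists>\<phi>\<in>test_functions \<Omega>. H1_norm \<Omega> (\<lambda>x. u x - \<phi> x) < \<epsilon>" if "\<epsilon> > 0" for \<epsilon>
      unfolding eq[OF that]
      using conjunct2[OF u, unfolded H1.approximable_def, rule_format, OF zero_less_power[OF that]] .
    with u show "u \<in> H01 \<Omega>" by (simp add: H01_def)
  qed
qed

lemma test_functions_H01:
  assumes "open \<Omega>" "test_functions_dense \<Omega>"
  shows "test_functions \<Omega> \<subseteq> H01 \<Omega>"
proof -
  interpret H1: function_semi_inner "H1 \<Omega>" "H1_inner \<Omega>" by (rule H1_inner_products[OF assms])
  show ?thesis
    using H1.approximable_self[OF _ test_functions_H1[OF assms(1)]] test_functions_H1[OF assms(1)]
    by (auto simp: H01_iff[OF assms])
qed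

lemma H01_cmult:
  assumes "open \<Omega>" "test_functions_dense \<Omega>" "u \<in> H01 \<Omega>"
  shows "(\<lambda>x. c * u x) \<in> H01 \<Omega>"
proof -
  interpret H1: function_semi_inner "H1 \<Omega>" "H1_inner \<Omega>" by (rule H1_inner_products[OF assms(1,2)])
  show ?thesis
    using assms(3) H1.approximable_scale[OF test_functions_H1[OF assms(1)] test_functions_cmult] H1.scale_mem
    unfolding H01_iff[OF assms(1,2)] by blast
qed

lemma H01_grad_approximable:
  assumes "open \<Omega>" "test_functions_dense \<Omega>" "u \<in> H01 \<Omega>"
  shows "function_semi_inner.approximable (grad_inner \<Omega>) (test_functions \<Omega>) u"
proof -
  interpret G: function_semi_inner "H1 \<Omega>" "grad_inner \<Omega>" by (rule H1_inner_products[OF assms(1,2)])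
  show ?thesis
    unfolding G.approximable_def
  proof (intro allI impI)
    fix \<epsilon> :: real assume "\<epsilon> > 0"
    then obtain \<phi> where \<phi>: "\<phi> \<in> test_functions \<Omega>" "H1_inner \<Omega> (\<lambda>x. u x - \<phi> x) (\<lambda>x. u x - \<phi> x) < \<epsilon>"
      using H01_approximation[OF assms(3)] by blast
    have "L2_inner \<Omega> (\<lambda>x. u x - \<phi> x) (\<lambda>x. u x - \<phi> x) \<ge> 0"
      by (simp add: L2_inner_def)
    then have "grad_inner \<Omega> (\<lambda>x. u x - \<phi> x) (\<lambda>x. u x - \<phi> x) < \<epsilon>"
      using \<phi>(2) by (simp add: H1_inner_def)
    with \<phi>(1) show "\<exists>\<phi>\<in>test_functions \<Omega>. grad_inner \<Omega> (\<lambda>x. u x - \<phi> x) (\<lambda>x. u x - \<phi> x) < \<epsilon>"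
      by (intro bexI)
  qed
qed

section \<open>Tensor products of functions\<close>

lemma tensor_eq: "tensor f g = (\<lambda>z. f (fst z) * g (snd z))"
  by (auto simp: tensor_def)

lemma product_lebesgue_on:
  fixes p :: "'a::euclidean_space \<Rightarrow> real" and q :: "'b::euclidean_space \<Rightarrow> real"
  assumes S: "open S" and T: "open T"
    and p: "integrable (lebesgue_on S) p" and q: "integrable (lebesgue_on T) q"
  shows "integrable (lebesgue_on (S \<times> T)) (\<lambda>z. p (fst z) * q (snd z))"
    and "(LINT z|lebesgue_on (S \<times> T). p (fst z) * q (snd z)) =
      (LINT x|lebesgue_on S. p x) * (LINT y|lebesgue_on T. q y)"
proof -
  have m: "(\<lambda>z. p (fst z)) \<in> borel_measurable (lebesgue_on (S \<times> T))"
    "(\<lambda>z. q (snd z)) \<in> borel_measurable (lebesgue_on (S \<times> T))"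
    using measurable_lebesgue_on_compose_fst[OF S T borel_measurable_integrable[OF p]]
      measurable_lebesgue_on_compose_snd[OF S T borel_measurable_integrable[OF q]] by auto
  have m2: "(\<lambda>z. \<bar>p (fst z)\<bar> * \<bar>q (snd z)\<bar>) \<in> borel_measurable (lebesgue_on (S \<times> T))"
    using m by measurable
  show i: "integrable (lebesgue_on (S \<times> T)) (\<lambda>z. p (fst z) * q (snd z))"
  proof (rule integrableI_bounded)
    show "(\<lambda>z. p (fst z) * q (snd z)) \<in> borel_measurable (lebesgue_on (S \<times> T))"
      using m by measurable
    have "(\<integral>\<^sup>+z. ennreal (norm (p (fst z) * q (snd z))) \<partial>lebesgue_on (S \<times> T)) =
        (\<integral>\<^sup>+x. (\<integral>\<^sup>+y. ennreal (\<bar>p x\<bar> * \<bar>q y\<bar>) \<partial>lebesgue_on T) \<partial>lebesgue_on S)"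
      using Tonelli_lebesgue_on(2)[OF S T m2] by (simp add: abs_mult)
    also have "\<dots> = (\<integral>\<^sup>+x. ennreal \<bar>p x\<bar> * (\<integral>\<^sup>+y. ennreal \<bar>q y\<bar> \<partial>lebesgue_on T) \<partial>lebesgue_on S)"
      using q by (simp add: ennreal_mult nn_integral_cmult)
    also have "\<dots> = (\<integral>\<^sup>+x. ennreal \<bar>p x\<bar> \<partial>lebesgue_on S) * (\<integral>\<^sup>+y. ennreal \<bar>q y\<bar> \<partial>lebesgue_on T)"
      using p by (simp add: nn_integral_multc)
    also have "\<dots> < \<infinity>"
      using p q by (simp add: integrable_iff_bounded ennreal_mult_less_top)
    finally show "(\<integral>\<^sup>+z. ennreal (norm (p (fst z) * q (snd z))) \<partial>lebesgue_on (S \<times> T)) < \<infinity>" .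
  qed
  show "(LINT z|lebesgue_on (S \<times> T). p (fst z) * q (snd z)) =
      (LINT x|lebesgue_on S. p x) * (LINT y|lebesgue_on T. q y)"
    by (subst Fubini_lebesgue_on(3)[OF S T i]) simp
qed

lemma L2_scaleR_fst:
  fixes a :: "'a::euclidean_space \<Rightarrow> 'c::euclidean_space" and q :: "'b::euclidean_space \<Rightarrow> real"
  assumes S: "open S" and T: "open T" and a: "a \<in> L2 S" and q: "q \<in> L2 T"
  shows "(\<lambda>z. q (snd z) *\<^sub>R a (fst z)) \<in> L2 (S \<times> T)"
proof -
  have m: "a \<in> borel_measurable (lebesgue_on S)" "q \<in> borel_measurable (lebesgue_on T)"
    and i: "integrable (lebesgue_on S) (\<lambda>x. (norm (a x))\<^sup>2)" "integrable (lebesgue_on T) (\<lambda>y. (q y)\<^sup>2)"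
    using a q by (auto simp: L2_def)
  have "(\<lambda>z. q (snd z) *\<^sub>R a (fst z)) \<in> borel_measurable (lebesgue_on (S \<times> T))"
    by (intro borel_measurable_scaleR measurable_lebesgue_on_compose_fst
        measurable_lebesgue_on_compose_snd S T m)
  then show ?thesis
    using product_lebesgue_on(1)[OF S T i] by (simp add: L2_def power_mult_distrib mult.commute)
qed

lemma L2_scaleR_snd:
  fixes p :: "'a::euclidean_space \<Rightarrow> real" and b :: "'b::euclidean_space \<Rightarrow> 'c::euclidean_space"
  assumes S: "open S" and T: "open T" and p: "p \<in> L2 S" and b: "b \<in> L2 T"
  shows "(\<lambda>z. p (fst z) *\<^sub>R b (snd z)) \<in> L2 (S \<times> T)"
proof -
  have m: "p \<in> borel_measurable (lebesgue_on S)" "b \<in> borel_measurable (lebesgue_on T)"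
    and i: "integrable (lebesgue_on S) (\<lambda>x. (p x)\<^sup>2)" "integrable (lebesgue_on T) (\<lambda>y. (norm (b y))\<^sup>2)"
    using p b by (auto simp: L2_def)
  have "(\<lambda>z. p (fst z) *\<^sub>R b (snd z)) \<in> borel_measurable (lebesgue_on (S \<times> T))"
    by (intro borel_measurable_scaleR measurable_lebesgue_on_compose_fst
        measurable_lebesgue_on_compose_snd S T m)
  then show ?thesis
    using product_lebesgue_on(1)[OF S T i] by (simp add: L2_def power_mult_distrib)
qed

lemma L2_Pair:
  fixes a :: "'a::euclidean_space \<Rightarrow> 'b::euclidean_space" and b :: "'a \<Rightarrow> 'c::euclidean_space"
  assumes "a \<in> L2 \<Omega>" "b \<in> L2 \<Omega>"
  shows "(\<lambda>z. (a z, b z)) \<in> L2 \<Omega>"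
  using assms by (simp add: L2_def norm_Pair borel_measurable_Pair)

lemma L2_fst_snd:
  fixes g :: "'a::euclidean_space \<Rightarrow> 'b::euclidean_space \<times> 'c::euclidean_space"
  assumes "g \<in> L2 \<Omega>"
  shows "(\<lambda>x. fst (g x)) \<in> L2 \<Omega>" "(\<lambda>x. snd (g x)) \<in> L2 \<Omega>"
proof -
  have g: "g \<in> borel_measurable (lebesgue_on \<Omega>)"
    and i: "integrable (lebesgue_on \<Omega>) (\<lambda>x. (norm (g x))\<^sup>2)"
    using assms by (auto simp: L2_def)
  have m: "(\<lambda>x. fst (g x)) \<in> borel_measurable (lebesgue_on \<Omega>)"
    "(\<lambda>x. snd (g x)) \<in> borel_measurable (lebesgue_on \<Omega>)"
    by (rule measurable_compose[OF g], rule borel_measurable_continuous_onI,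
        intro continuous_on_fst continuous_on_snd continuous_on_id)+
  have le: "(norm (fst z))\<^sup>2 \<le> (norm z)\<^sup>2" "(norm (snd z))\<^sup>2 \<le> (norm z)\<^sup>2" for z :: "'b \<times> 'c"
    by (cases z, simp add: norm_prod_def)+
  have "integrable (lebesgue_on \<Omega>) (\<lambda>x. (norm (fst (g x)))\<^sup>2)"
    by (rule Bochner_Integration.integrable_bound[OF i])
       (use m le in auto)
  moreover have "integrable (lebesgue_on \<Omega>) (\<lambda>x. (norm (snd (g x)))\<^sup>2)"
    by (rule Bochner_Integration.integrable_bound[OF i])
       (use m le in auto)
  ultimately show "(\<lambda>x. fst (g x)) \<in> L2 \<Omega>" "(\<lambda>x. snd (g x)) \<in> L2 \<Omega>"
    using m by (auto simp: L2_def)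
qed

lemma L2_tensor:
  assumes "open S" "open T" "f \<in> L2 S" "g \<in> L2 T"
  shows "tensor f g \<in> L2 (S \<times> T)"
  using L2_scaleR_snd[OF assms] by (simp add: tensor_eq)

lemma L2_inner_tensor:
  assumes S: "open S" and T: "open T" and f: "f \<in> L2 S" "f' \<in> L2 S" and g: "g \<in> L2 T" "g' \<in> L2 T"
  shows "L2_inner (S \<times> T) (tensor f g) (tensor f' g') = L2_inner S f f' * L2_inner T g g'"
  using product_lebesgue_on(2)[OF S T L2_integrable_mult[OF f] L2_integrable_mult[OF g]]
  by (simp add: L2_inner_def tensor_eq mult_ac)

lemma Ck_mult: "Ck k f \<Longrightarrow> Ck k g \<Longrightarrow> Ck k (\<lambda>x. f x * g x)"
proof (induction k arbitrary: f g)
  case (Suc k)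
  have d: "((\<lambda>x. f x * g x) has_derivative
      (\<lambda>b. f x * frechet_derivative g (at x) b + frechet_derivative f (at x) b * g x)) (at x)" for x
    using Suc.prems by (intro has_derivative_mult has_derivative_frechet) auto
  have "Ck k (\<lambda>x. f x * frechet_derivative g (at x) b + frechet_derivative f (at x) b * g x)"
    if "b \<in> Basis" for b
    using Suc.prems that by (intro Ck_add Suc.IH Ck_Suc_imp_Ck[OF Suc.prems(1)] Ck_Suc_imp_Ck[OF Suc.prems(2)]) auto
  then show ?case
    using d by (auto simp: differentiable_def frechet_derivative_at[OF d, symmetric])
qed (auto intro: continuous_on_mult)

lemma frechet_derivative_compose_affine:
  assumes A: "\<And>x. (A has_derivative T) (at x)" and f: "f differentiable at (A x)"
  shows "((\<lambda>x. f (A x)) has_derivative (\<lambda>b. frechet_derivative f (at (A x)) (T b))) (at x)"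
  using has_derivative_compose[OF A has_derivative_frechet[OF f]] .

text \<open>
  Differentiability of order \<open>k\<close> is defined through partial derivatives along basis vectors. It is
  therefore stable under maps with constant derivative that send each basis vector to a basis vector or
  to \<open>0\<close>. Slicing, both projections and the exchange of factors are of this kind.
\<close>
lemma Ck_compose_affine:
  fixes A :: "'a::euclidean_space \<Rightarrow> 'b::euclidean_space"
  assumes A: "\<And>x. (A has_derivative T) (at x)" and T: "\<And>b. b \<in> Basis \<Longrightarrow> T b \<in> insert 0 Basis"
  shows "Ck k f \<Longrightarrow> Ck k (\<lambda>x. f (A x))"
proof (induction k arbitrary: f)
  case 0
  have "continuous_on UNIV A"
    using has_derivative_continuous[OF A] by (simp add: continuous_on_eq_continuous_at)
  with 0 show ?case by (auto intro: continuous_on_compose2[of UNIV f])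
next
  case (Suc k)
  have d: "((\<lambda>x. f (A x)) has_derivative (\<lambda>b. frechet_derivative f (at (A x)) (T b))) (at x)" for x
    using Suc.prems by (intro frechet_derivative_compose_affine A) auto
  have "Ck k (\<lambda>x. frechet_derivative f (at (A x)) (T b))" if "b \<in> Basis" for b
  proof (cases "T b = 0")
    case True
    have "linear (frechet_derivative f (at (A x)))" for x
      using Suc.prems by (intro linear_frechet_derivative) auto
    then show ?thesis using True by (simp add: linear_0 Ck_0)
  next
    case False
    with T[OF that] Suc.prems show ?thesis
      by (intro Suc.IH[of "\<lambda>z. frechet_derivative f (at z) (T b)"]) auto
  qed
  then show ?case
    using d by (auto simp: differentiable_def frechet_derivative_at[OF d, symmetric])
qed

lemma has_derivative_Pair_left: "((\<lambda>x. (x, y)) has_derivative (\<lambda>x. (x, 0))) (at x)"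
  and has_derivative_fst_id: "(fst has_derivative fst) (at z)"
  and has_derivative_snd_id: "(snd has_derivative snd) (at z)"
  and has_derivative_swap: "(prod.swap has_derivative prod.swap) (at w)"
  unfolding prod.swap_def by (auto intro!: derivative_eq_intros)

lemma test_functions_section_fst:
  fixes \<Phi> :: "'a::euclidean_space \<times> 'b::euclidean_space \<Rightarrow> real"
  assumes \<Phi>: "\<Phi> \<in> test_functions (S \<times> T)"
  shows "(\<lambda>x. \<Phi> (x, y)) \<in> test_functions S"
    and "frechet_derivative (\<lambda>x. \<Phi> (x, y)) (at x) b = frechet_derivative \<Phi> (at (x, y)) (b, 0)"
proof -
  obtain K where K: "compact K" "K \<subseteq> S \<times> T" "\<And>z. z \<notin> K \<Longrightarrow> \<Phi> z = 0"
    using test_functionsE[OF \<Phi>] by metis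
  show "(\<lambda>x. \<Phi> (x, y)) \<in> test_functions S"
  proof (rule test_functionsI)
    show "Ck k (\<lambda>x. \<Phi> (x, y))" for k
      using \<Phi> by (intro Ck_compose_affine[OF has_derivative_Pair_left]) (auto simp: test_functions_def Basis_prod_def)
    show "compact (fst ` K)" using K(1) by (intro compact_continuous_image continuous_on_fst continuous_on_id)
    show "fst ` K \<subseteq> S" using K(2) by auto
    show "\<Phi> (x, y) = 0" if "x \<notin> fst ` K" for x using that K(3)[of "(x, y)"] by force
  qed
  show "frechet_derivative (\<lambda>x. \<Phi> (x, y)) (at x) b = frechet_derivative \<Phi> (at (x, y)) (b, 0)"
    using frechet_derivative_at[OF frechet_derivative_compose_affine[OF has_derivative_Pair_left
          test_functionsD(1)[OF \<Phi>]]] by metis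
qed

lemma test_functions_swap:
  fixes \<Phi> :: "'a::euclidean_space \<times> 'b::euclidean_space \<Rightarrow> real"
  assumes \<Phi>: "\<Phi> \<in> test_functions (S \<times> T)"
  shows "(\<lambda>z. \<Phi> (prod.swap z)) \<in> test_functions (T \<times> S)"
    and "frechet_derivative (\<lambda>z. \<Phi> (prod.swap z)) (at z) b = frechet_derivative \<Phi> (at (prod.swap z)) (prod.swap b)"
proof -
  obtain K where K: "compact K" "K \<subseteq> S \<times> T" "\<And>z. z \<notin> K \<Longrightarrow> \<Phi> z = 0"
    using test_functionsE[OF \<Phi>] by metis
  show "(\<lambda>z. \<Phi> (prod.swap z)) \<in> test_functions (T \<times> S)"
  proof (rule test_functionsI)
    show "Ck k (\<lambda>z. \<Phi> (prod.swap z))" for k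
      using \<Phi> by (intro Ck_compose_affine[OF has_derivative_swap]) (auto simp: test_functions_def Basis_prod_def)
    show "compact (prod.swap ` K)" using K(1)
      unfolding prod.swap_def by (intro compact_continuous_image continuous_intros)
    show "prod.swap ` K \<subseteq> T \<times> S" using K(2) by auto
    show "\<Phi> (prod.swap z) = 0" if "z \<notin> prod.swap ` K" for z
      using that K(3)[of "prod.swap z"] by (metis image_eqI swap_swap)
  qed
  show "frechet_derivative (\<lambda>z. \<Phi> (prod.swap z)) (at z) b = frechet_derivative \<Phi> (at (prod.swap z)) (prod.swap b)"
    using frechet_derivative_at[OF frechet_derivative_compose_affine[OF has_derivative_swap
          test_functionsD(1)[OF \<Phi>]]] by metis
qed

lemma test_functions_section_snd:
  fixes \<Phi> :: "'a::euclidean_space \<times> 'b::euclidean_space \<Rightarrow> real"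
  assumes \<Phi>: "\<Phi> \<in> test_functions (S \<times> T)"
  shows "(\<lambda>y. \<Phi> (x, y)) \<in> test_functions T"
    and "frechet_derivative (\<lambda>y. \<Phi> (x, y)) (at y) b = frechet_derivative \<Phi> (at (x, y)) (0, b)"
  using test_functions_section_fst[OF test_functions_swap(1)[OF \<Phi>], of x]
    test_functions_swap(2)[OF \<Phi>, of "(y, x)" "(b, 0)"] by simp_all

lemma test_functions_tensor:
  assumes \<phi>: "\<phi> \<in> test_functions S" and \<psi>: "\<psi> \<in> test_functions T"
  shows "tensor \<phi> \<psi> \<in> test_functions (S \<times> T)"
proof -
  obtain K where K: "compact K" "K \<subseteq> S" "\<And>z. z \<notin> K \<Longrightarrow> \<phi> z = 0"
    using test_functionsE[OF \<phi>] by metis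
  obtain L where L: "compact L" "L \<subseteq> T" "\<And>z. z \<notin> L \<Longrightarrow> \<psi> z = 0"
    using test_functionsE[OF \<psi>] by metis
  show ?thesis
    unfolding tensor_eq
  proof (rule test_functionsI)
    have "Ck k (\<lambda>z::'a \<times> 'b. \<phi> (fst z))" for k
      using \<phi> by (intro Ck_compose_affine[OF has_derivative_fst_id]) (auto simp: test_functions_def Basis_prod_def)
    moreover have "Ck k (\<lambda>z::'a \<times> 'b. \<psi> (snd z))" for k
      using \<psi> by (intro Ck_compose_affine[OF has_derivative_snd_id]) (auto simp: test_functions_def Basis_prod_def)
    ultimately show "Ck k (\<lambda>z. \<phi> (fst z) * \<psi> (snd z))" for k
      by (rule Ck_mult)
    show "compact (K \<times> L)" using K L by (intro compact_Times)
    show "K \<times> L \<subseteq> S \<times> T" using K L by auto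
    show "\<phi> (fst z) * \<psi> (snd z) = 0" if "z \<notin> K \<times> L" for z
      using that K(3) L(3) by (auto simp: mem_Times_iff)
  qed
qed

lemma classical_grad_product:
  assumes "\<Phi> \<in> test_functions (S \<times> T)"
  shows "classical_grad \<Phi> (x, y) = (classical_grad (\<lambda>x. \<Phi> (x, y)) x, classical_grad (\<lambda>y. \<Phi> (x, y)) y)"
proof -
  have "classical_grad \<Phi> (x, y) =
      (\<Sum>b\<in>Basis. frechet_derivative \<Phi> (at (x, y)) (b, 0) *\<^sub>R (b, 0)) +
      (\<Sum>b\<in>Basis. frechet_derivative \<Phi> (at (x, y)) (0, b) *\<^sub>R (0, b))"
    unfolding classical_grad_def by (rule sum_Basis_prod_eq)
  then show ?thesis
    by (simp add: classical_grad_def prod_eq_iff fst_sum snd_sum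
        test_functions_section_fst(2)[OF assms] test_functions_section_snd(2)[OF assms])
qed

text \<open>
  A basis direction of the product lies in one of the factors. For a direction in the first factor,
  integrate over that factor first: the slice of a test function is a test function there, so the
  weak gradient of \<open>e\<close> applies for each fixed \<open>y\<close>, with \<open>f y\<close> as a constant factor.
\<close>
lemma has_weak_gradient_tensor:
  assumes S: "open S" and T: "open T" and e: "e \<in> L2 S" and f: "f \<in> L2 T"
    and ge: "has_weak_gradient S e ge" and gf: "has_weak_gradient T f gf"
  shows "has_weak_gradient (S \<times> T) (tensor e f) (\<lambda>z. (f (snd z) *\<^sub>R ge (fst z), e (fst z) *\<^sub>R gf (snd z)))"
    (is "has_weak_gradient _ _ ?G")
  unfolding has_weak_gradient_def
proof (intro conjI ballI)
  have gL: "ge \<in> L2 S" "gf \<in> L2 T" using ge gf by (auto simp: has_weak_gradient_def)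
  show G: "?G \<in> L2 (S \<times> T)"
    by (intro L2_Pair L2_scaleR_fst L2_scaleR_snd S T e f gL)
  have ST: "open (S \<times> T)" using S T by (rule open_Times)
  have t: "tensor e f \<in> L2 (S \<times> T)" using S T e f by (rule L2_tensor)
  fix \<Phi> b assume \<Phi>: "\<Phi> \<in> test_functions (S \<times> T)" and b: "b \<in> (Basis :: ('a \<times> 'b) set)"
  have i1: "integrable (lebesgue_on (S \<times> T)) (\<lambda>z. tensor e f z * frechet_derivative \<Phi> (at z) b)"
    by (intro L2_integrable_mult t test_functions_L2 ST test_functions_derivative \<Phi> b)
  have i2: "integrable (lebesgue_on (S \<times> T)) (\<lambda>z. (?G z \<bullet> b) * \<Phi> z)"
    by (intro L2_integrable_mult L2_component G b test_functions_L2 ST \<Phi>)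
  consider i where "b = (i, 0)" "i \<in> Basis" | j where "b = (0, j)" "j \<in> Basis"
    using b by (auto simp: Basis_prod_def)
  then show "(LINT z|lebesgue_on (S \<times> T). tensor e f z * frechet_derivative \<Phi> (at z) b) =
      - (LINT z|lebesgue_on (S \<times> T). (?G z \<bullet> b) * \<Phi> z)"
  proof cases
    case (1 i)
    have "(LINT x|lebesgue_on S. tensor e f (x, y) * frechet_derivative \<Phi> (at (x, y)) b) =
        - (LINT x|lebesgue_on S. (?G (x, y) \<bullet> b) * \<Phi> (x, y))" for y
    proof -
      have "(LINT x|lebesgue_on S. e x * frechet_derivative (\<lambda>x. \<Phi> (x, y)) (at x) i) =
          - (LINT x|lebesgue_on S. (ge x \<bullet> i) * \<Phi> (x, y))"
        using ge test_functions_section_fst(1)[OF \<Phi>] \<open>i \<in> Basis\<close> unfolding has_weak_gradient_def by blast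
      then have "f y * (LINT x|lebesgue_on S. e x * frechet_derivative \<Phi> (at (x, y)) b) =
          - (f y * (LINT x|lebesgue_on S. (ge x \<bullet> i) * \<Phi> (x, y)))"
        using 1(1) by (simp add: test_functions_section_fst(2)[OF \<Phi>])
      then show ?thesis
        using 1(1) by (simp add: tensor_eq inner_Pair mult.assoc mult.left_commute[of _ "f y"]
            del: integral_mult_left_zero flip: integral_mult_right_zero)
    qed
    then show ?thesis
      unfolding Fubini_lebesgue_on_swap(3)[OF S T i1] Fubini_lebesgue_on_swap(3)[OF S T i2] by simp
  next
    case (2 j)
    have "(LINT y|lebesgue_on T. tensor e f (x, y) * frechet_derivative \<Phi> (at (x, y)) b) =
        - (LINT y|lebesgue_on T. (?G (x, y) \<bullet> b) * \<Phi> (x, y))" for x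
    proof -
      have "(LINT y|lebesgue_on T. f y * frechet_derivative (\<lambda>y. \<Phi> (x, y)) (at y) j) =
          - (LINT y|lebesgue_on T. (gf y \<bullet> j) * \<Phi> (x, y))"
        using gf test_functions_section_snd(1)[OF \<Phi>] \<open>j \<in> Basis\<close> unfolding has_weak_gradient_def by blast
      then have "e x * (LINT y|lebesgue_on T. f y * frechet_derivative \<Phi> (at (x, y)) b) =
          - (e x * (LINT y|lebesgue_on T. (gf y \<bullet> j) * \<Phi> (x, y)))"
        using 2(1) by (simp add: test_functions_section_snd(2)[OF \<Phi>])
      then show ?thesis
        using 2(1) by (simp add: tensor_eq inner_Pair mult.assoc
            del: integral_mult_left_zero flip: integral_mult_right_zero)
    qed
    then show ?thesis
      unfolding Fubini_lebesgue_on(3)[OF S T i1] Fubini_lebesgue_on(3)[OF S T i2] by simp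
  qed
qed

lemma H1_tensor:
  assumes "open S" "open T" "e \<in> H1 S" "f \<in> H1 T"
  shows "tensor e f \<in> H1 (S \<times> T)"
  by (rule H1I[OF L2_tensor[OF assms(1,2)] has_weak_gradient_tensor[OF assms(1,2)]])
     (use assms in \<open>auto intro: H1_imp_L2 has_weak_gradient_weak_grad\<close>)

lemma grad_inner_tensor:
  assumes S: "open S" and T: "open T" and dense: "test_functions_dense (S \<times> T)"
    and e: "e \<in> H1 S" "e' \<in> H1 S" and f: "f \<in> H1 T" "f' \<in> H1 T"
  shows "grad_inner (S \<times> T) (tensor e f) (tensor e' f') =
    grad_inner S e e' * L2_inner T f f' + L2_inner S e e' * grad_inner T f f'"
proof -
  note w = has_weak_gradient_weak_grad
  have L: "e \<in> L2 S" "e' \<in> L2 S" "f \<in> L2 T" "f' \<in> L2 T"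
    using e f by (auto intro: H1_imp_L2)
  have gL: "weak_grad S e \<in> L2 S" "weak_grad S e' \<in> L2 S" "weak_grad T f \<in> L2 T" "weak_grad T f' \<in> L2 T"
    using w[OF e(1)] w[OF e(2)] w[OF f(1)] w[OF f(2)] by (auto simp: has_weak_gradient_def)
  note i1 = product_lebesgue_on[OF S T L2_integrable_inner[OF gL(1,2)] L2_integrable_mult[OF L(3,4)]]
  note i2 = product_lebesgue_on[OF S T L2_integrable_mult[OF L(1,2)] L2_integrable_inner[OF gL(3,4)]]
  have "grad_inner (S \<times> T) (tensor e f) (tensor e' f') =
      (LINT z|lebesgue_on (S \<times> T).
        (weak_grad S e (fst z) \<bullet> weak_grad S e' (fst z)) * (f (snd z) * f' (snd z)) +
        e (fst z) * e' (fst z) * (weak_grad T f (snd z) \<bullet> weak_grad T f' (snd z)))"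
    unfolding grad_inner_eq[OF open_Times[OF S T] dense
        has_weak_gradient_tensor[OF S T L(1) L(3) w[OF e(1)] w[OF f(1)]]
        has_weak_gradient_tensor[OF S T L(2) L(4) w[OF e(2)] w[OF f(2)]]]
    by (simp add: inner_Pair mult_ac)
  also have "\<dots> = grad_inner S e e' * L2_inner T f f' + L2_inner S e e' * grad_inner T f f'"
    using i1 i2 by (simp add: grad_inner_def L2_inner_def)
  finally show ?thesis .
qed

text \<open>
  With \<open>A, A'\<close> the squared \<open>L\<^sup>2\<close> and gradient norms of \<open>e\<close>, and \<open>B, B'\<close> those of \<open>f\<close>, the left side is
  \<open>A B + A' B + A B'\<close>; the right side has the additional term \<open>A' B'\<close>.
\<close>
lemma H1_inner_tensor_le:
  assumes S: "open S" and T: "open T" and dense: "test_functions_dense (S \<times> T)"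
    and e: "e \<in> H1 S" and f: "f \<in> H1 T"
  shows "H1_inner (S \<times> T) (tensor e f) (tensor e f) \<le> H1_inner S e e * H1_inner T f f"
proof -
  have "grad_inner S e e * grad_inner T f f \<ge> 0"
    by (intro mult_nonneg_nonneg grad_inner_self_nonneg)
  then show ?thesis
    using L2_inner_tensor[OF S T H1_imp_L2[OF e] H1_imp_L2[OF e] H1_imp_L2[OF f] H1_imp_L2[OF f]]
      grad_inner_tensor[OF S T dense e e f f]
    by (simp add: H1_inner_def algebra_simps)
qed

lemma L2_approximable_tensor:
  assumes S: "open S" and T: "open T"
    and e: "e \<in> L2 S" "L2.approximable S (test_functions S) e"
    and f: "f \<in> L2 T" "L2.approximable T (test_functions T) f"
  shows "L2.approximable (S \<times> T) (test_functions (S \<times> T)) (tensor e f)"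
  by (rule tensor_approximable[OF L2.function_semi_inner_axioms L2.function_semi_inner_axioms
        L2.function_semi_inner_axioms _ _ _ _ test_functions_tensor e f])
     (auto intro: L2_tensor test_functions_L2 S T simp: L2_inner_tensor[OF S T])

lemma H01_tensor:
  assumes S: "open S" and T: "open T"
    and dense: "test_functions_dense S" "test_functions_dense T" "test_functions_dense (S \<times> T)"
    and e: "e \<in> H01 S" and f: "f \<in> H01 T"
  shows "tensor e f \<in> H01 (S \<times> T)"
proof -
  have ef: "e \<in> H1 S" "function_semi_inner.approximable (H1_inner S) (test_functions S) e"
    "f \<in> H1 T" "function_semi_inner.approximable (H1_inner T) (test_functions T) f"
    using e f by (auto simp: H01_iff[OF S dense(1)] H01_iff[OF T dense(2)])
  have "function_semi_inner.approximable (H1_inner (S \<times> T)) (test_functions (S \<times> T)) (tensor e f)"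
  proof (rule tensor_approximable)
    show "function_semi_inner (H1 (S \<times> T)) (H1_inner (S \<times> T))" "function_semi_inner (H1 S) (H1_inner S)"
      "function_semi_inner (H1 T) (H1_inner T)"
      using S T dense by (auto intro: H1_inner_products open_Times)
    show "tensor a b \<in> H1 (S \<times> T)" if "a \<in> H1 S" "b \<in> H1 T" for a b
      using S T that by (rule H1_tensor)
    show "H1_inner (S \<times> T) (tensor a b) (tensor a b) \<le> H1_inner S a a * H1_inner T b b"
      if "a \<in> H1 S" "b \<in> H1 T" for a b
      using S T dense(3) that by (rule H1_inner_tensor_le)
    show "test_functions S \<subseteq> H1 S" "test_functions T \<subseteq> H1 T"
      using S T by (auto dest: test_functions_H1)
    show "tensor a b \<in> test_functions (S \<times> T)"
      if "a \<in> test_functions S" "b \<in> test_functions T" for a b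
      using that by (rule test_functions_tensor)
  qed (rule ef)+
  with H1_tensor[OF S T ef(1,3)] show ?thesis
    by (simp add: H01_iff[OF open_Times[OF S T] dense(3)])
qed

section \<open>Parseval identity by slices\<close>

text \<open>
  On a bounded set constants are square integrable. Coefficients of slices are integrals of a function
  on the product against \<open>e \<otimes> 1\<close>, which therefore lies in \<open>L\<^sup>2\<close>, and Fubini's theorem gives their
  measurability.
\<close>
lemma bounded_imp_const_L2:
  fixes T :: "'b::euclidean_space set"
  assumes "open T" "bounded T"
  shows "(\<lambda>y. c::real) \<in> L2 T"
proof -
  have "emeasure lebesgue T < \<infinity>"
    using assms emeasure_bounded_finite[OF assms(2)] by (simp add: emeasure_completion)
  then have "finite_measure (lebesgue_on T)"
    using assms by (intro finite_measureI) (simp add: emeasure_restrict_space less_top[symmetric])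
  then show ?thesis
    by (simp add: L2_def finite_measure.integrable_const)
qed

lemma L2_slices:
  fixes v :: "'a::euclidean_space \<times> 'b::euclidean_space \<Rightarrow> real"
  assumes S: "open S" and T: "open T" and v: "v \<in> L2 (S \<times> T)"
  shows "AE y in lebesgue_on T. (\<lambda>x. v (x, y)) \<in> L2 S"
    and "integrable (lebesgue_on T) (\<lambda>y. LINT x|lebesgue_on S. (v (x, y))\<^sup>2)"
proof -
  have m: "v \<in> borel_measurable (lebesgue_on (S \<times> T))"
    and i: "integrable (lebesgue_on (S \<times> T)) (\<lambda>z. (v z)\<^sup>2)"
    using v by (auto simp: L2_def)
  show "AE y in lebesgue_on T. (\<lambda>x. v (x, y)) \<in> L2 S"
    using Tonelli_lebesgue_on_swap(1)[OF S T m] Fubini_lebesgue_on_swap(1)[OF S T i]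
    by eventually_elim (simp add: L2_def)
  show "integrable (lebesgue_on T) (\<lambda>y. LINT x|lebesgue_on S. (v (x, y))\<^sup>2)"
    by (rule Fubini_lebesgue_on_swap(2)[OF S T i])
qed

text \<open>
  Expanding only in the first variable: the coefficient of the slice \<open>v(\<cdot>, y)\<close> is a square
  integrable function of \<open>y\<close>, and its own coefficients are those of \<open>v\<close> with respect to tensors.
\<close>
lemma L2_partial_coefficients:
  fixes v :: "'a::euclidean_space \<times> 'b::euclidean_space \<Rightarrow> real"
  assumes S: "open S" and T: "open T" "bounded T" and v: "v \<in> L2 (S \<times> T)"
    and e: "e \<in> L2 S" "L2_inner S e e = 1"
  shows "(\<lambda>y. L2_inner S (\<lambda>x. v (x, y)) e) \<in> L2 T"
    and "f \<in> L2 T \<Longrightarrow> L2_inner T (\<lambda>y. L2_inner S (\<lambda>x. v (x, y)) e) f = L2_inner (S \<times> T) v (tensor e f)"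
proof -
  let ?a = "\<lambda>y. L2_inner S (\<lambda>x. v (x, y)) e"
  have "integrable (lebesgue_on (S \<times> T)) (\<lambda>z. v z * tensor e (\<lambda>y. 1) z)"
    by (intro L2_integrable_mult v L2_tensor S T e bounded_imp_const_L2)
  from Fubini_lebesgue_on_swap(2)[OF S T(1) this]
  have m: "?a \<in> borel_measurable (lebesgue_on T)"
    by (auto simp: tensor_eq L2_inner_def)
  have "integrable (lebesgue_on T) (\<lambda>y. (?a y)\<^sup>2)"
  proof (rule Bochner_Integration.integrable_bound[OF L2_slices(2)[OF S T(1) v]])
    show "AE y in lebesgue_on T. norm ((?a y)\<^sup>2) \<le> norm (LINT x|lebesgue_on S. (v (x, y))\<^sup>2)"
      using L2_slices(1)[OF S T(1) v]
    proof eventually_elim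
      case (elim y)
      \<comment> \<open>Bessel's inequality for a single unit vector plays the role of Cauchy-Schwarz.\<close>
      have "(\<Sum>i\<in>{()}. (L2_inner S (\<lambda>x. v (x, y)) ((\<lambda>_. e) i))\<^sup>2) \<le> L2_inner S (\<lambda>x. v (x, y)) (\<lambda>x. v (x, y))"
        by (rule L2.Bessel_finite[where e="\<lambda>_::unit. e"]) (use elim e in auto)
      then show ?case by (simp add: L2_inner_self)
    qed
  qed (use m in measurable)
  with m show "?a \<in> L2 T" by (simp add: L2_def)
  assume f: "f \<in> L2 T"
  have i: "integrable (lebesgue_on (S \<times> T)) (\<lambda>z. v z * tensor e f z)"
    by (intro L2_integrable_mult v L2_tensor S T e f)
  have "L2_inner (S \<times> T) v (tensor e f) = (LINT y|lebesgue_on T. LINT x|lebesgue_on S. v (x, y) * e x * f y)"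
    unfolding L2_inner_def Fubini_lebesgue_on_swap(3)[OF S T(1) i] by (simp add: tensor_eq mult.assoc)
  then show "L2_inner T ?a f = L2_inner (S \<times> T) v (tensor e f)"
    by (simp add: L2_inner_def)
qed

text \<open>
  Summing over \<open>k\<close> is Parseval's identity for the coefficient functions in the second variable; the
  sum over \<open>j\<close> is then taken under the integral over \<open>y\<close>, where the hypothesis on slices evaluates it.
  The weights and the density \<open>G\<close> are left open because two identities have this form: weights \<open>1\<close>
  with \<open>G = v\<^sup>2\<close>, and eigenvalues as weights with \<open>G\<close> the squared norm of the gradient in the first
  variable.
\<close>
lemma Parseval_by_slices:
  fixes v :: "'a::euclidean_space \<times> 'b::euclidean_space \<Rightarrow> real" and e :: "nat \<Rightarrow> 'a \<Rightarrow> real" and f :: "nat \<Rightarrow> 'b \<Rightarrow> real"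
  assumes S: "open S" and T: "open T" "bounded T" and v: "v \<in> L2 (S \<times> T)"
    and e: "\<And>j. e j \<in> L2 S" "\<And>j. L2_inner S (e j) (e j) = 1"
    and f: "orthonormal_basis (L2 T) (L2_inner T) f"
    and w: "\<And>j. w j \<ge> 0" and G: "G \<in> borel_measurable (lebesgue_on (S \<times> T))"
    and slice: "AE y in lebesgue_on T. (\<Sum>j. ennreal (w j * (L2_inner S (\<lambda>x. v (x, y)) (e j))\<^sup>2)) =
      (\<integral>\<^sup>+x. ennreal (G (x, y)) \<partial>lebesgue_on S)"
  shows "(\<Sum>j. \<Sum>k. ennreal (w j * (L2_inner (S \<times> T) v (tensor (e j) (f k)))\<^sup>2)) =
    (\<integral>\<^sup>+z. ennreal (G z) \<partial>lebesgue_on (S \<times> T))"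
proof -
  let ?a = "\<lambda>j y. L2_inner S (\<lambda>x. v (x, y)) (e j)"
  note a = L2_partial_coefficients[OF S T v e]
  have fL: "f k \<in> L2 T" for k using f by (auto simp: orthonormal_basis_def)
  have m: "?a j \<in> borel_measurable (lebesgue_on T)" for j using a(1)[of j] by (simp add: L2_def)
  have "(\<Sum>k. ennreal (w j * (L2_inner (S \<times> T) v (tensor (e j) (f k)))\<^sup>2)) =
      (\<integral>\<^sup>+y. ennreal (w j * (?a j y)\<^sup>2) \<partial>lebesgue_on T)" for j
  proof -
    have "(\<Sum>k. ennreal (w j * (L2_inner (S \<times> T) v (tensor (e j) (f k)))\<^sup>2)) =
        ennreal (w j) * (\<Sum>k. ennreal ((L2_inner T (?a j) (f k))\<^sup>2))"
      by (simp add: a(2) fL ennreal_mult w)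
    also have "\<dots> = ennreal (w j) * ennreal (L2_inner T (?a j) (?a j))"
      by (simp add: L2.Parseval_suminf[OF f order_refl a(1)])
    also have "\<dots> = ennreal (w j) * (\<integral>\<^sup>+y. ennreal ((?a j y)\<^sup>2) \<partial>lebesgue_on T)"
      using a(1)[of j] by (simp add: L2_inner_self L2_def nn_integral_eq_integral)
    also have "\<dots> = (\<integral>\<^sup>+y. ennreal (w j * (?a j y)\<^sup>2) \<partial>lebesgue_on T)"
      using m[of j] by (simp add: ennreal_mult w nn_integral_cmult)
    finally show ?thesis .
  qed
  then have "(\<Sum>j. \<Sum>k. ennreal (w j * (L2_inner (S \<times> T) v (tensor (e j) (f k)))\<^sup>2)) =
      (\<Sum>j. \<integral>\<^sup>+y. ennreal (w j * (?a j y)\<^sup>2) \<partial>lebesgue_on T)" by simp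
  also have "\<dots> = (\<integral>\<^sup>+y. (\<Sum>j. ennreal (w j * (?a j y)\<^sup>2)) \<partial>lebesgue_on T)"
    using m by (intro nn_integral_suminf[symmetric]) auto
  also have "\<dots> = (\<integral>\<^sup>+y. (\<integral>\<^sup>+x. ennreal (G (x, y)) \<partial>lebesgue_on S) \<partial>lebesgue_on T)"
    by (rule nn_integral_cong_AE[OF slice])
  also have "\<dots> = (\<integral>\<^sup>+z. ennreal (G z) \<partial>lebesgue_on (S \<times> T))"
    by (rule Tonelli_lebesgue_on_swap(2)[OF S T(1) G, symmetric])
  finally show ?thesis .
qed

lemma L2_Parseval_tensor:
  fixes v :: "'a::euclidean_space \<times> 'b::euclidean_space \<Rightarrow> real" and e :: "nat \<Rightarrow> 'a \<Rightarrow> real" and f :: "nat \<Rightarrow> 'b \<Rightarrow> real"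
  assumes S: "open S" and T: "open T" "bounded T" and v: "v \<in> L2 (S \<times> T)"
    and e: "orthonormal_basis (L2 S) (L2_inner S) e" and f: "orthonormal_basis (L2 T) (L2_inner T) f"
  shows "(\<Sum>j. \<Sum>k. ennreal ((L2_inner (S \<times> T) v (tensor (e j) (f k)))\<^sup>2)) = ennreal (L2_inner (S \<times> T) v v)"
proof -
  have eL: "e j \<in> L2 S" "L2_inner S (e j) (e j) = 1" for j using e by (auto simp: orthonormal_basis_def)
  have m: "v \<in> borel_measurable (lebesgue_on (S \<times> T))" using v by (simp add: L2_def)
  have "(\<Sum>j. \<Sum>k. ennreal (1 * (L2_inner (S \<times> T) v (tensor (e j) (f k)))\<^sup>2)) =
      (\<integral>\<^sup>+z. ennreal ((v z)\<^sup>2) \<partial>lebesgue_on (S \<times> T))"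
  proof (rule Parseval_by_slices[where w="\<lambda>_. 1", OF S T v eL f])
    show "(\<lambda>z. (v z)\<^sup>2) \<in> borel_measurable (lebesgue_on (S \<times> T))"
      using m by measurable
    show "AE y in lebesgue_on T. (\<Sum>j. ennreal (1 * (L2_inner S (\<lambda>x. v (x, y)) (e j))\<^sup>2)) =
        (\<integral>\<^sup>+x. ennreal ((v (x, y))\<^sup>2) \<partial>lebesgue_on S)"
      using L2_slices(1)[OF S T(1) v]
    proof eventually_elim
      case (elim y)
      have "(\<integral>\<^sup>+x. ennreal ((v (x, y))\<^sup>2) \<partial>lebesgue_on S) =
          ennreal (L2_inner S (\<lambda>x. v (x, y)) (\<lambda>x. v (x, y)))"
        using elim by (simp add: L2_inner_self L2_def nn_integral_eq_integral)
      with L2.Parseval_suminf[OF e order_refl elim] show ?case by simp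
    qed
  qed simp
  also have "\<dots> = ennreal (L2_inner (S \<times> T) v v)"
    using v by (simp add: L2_inner_self L2_def nn_integral_eq_integral)
  finally show ?thesis by simp
qed

lemma L2_orthonormal_basis_tensor:
  fixes e :: "nat \<Rightarrow> 'a::euclidean_space \<Rightarrow> real" and f :: "nat \<Rightarrow> 'b::euclidean_space \<Rightarrow> real"
  assumes S: "open S" and T: "open T" "bounded T"
    and e: "orthonormal_basis (L2 S) (L2_inner S) e" and f: "orthonormal_basis (L2 T) (L2_inner T) f"
  shows "orthonormal_basis (L2 (S \<times> T)) (L2_inner (S \<times> T)) (\<lambda>(j, k). tensor (e j) (f k))"
proof (rule L2.orthonormal_basisI[where D="L2 (S \<times> T)"])
  have eL: "e j \<in> L2 S" and fL: "f k \<in> L2 T" for j k using e f by (auto simp: orthonormal_basis_def)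
  have on: "L2_inner S (e i) (e j) = (if i = j then 1 else 0)" "L2_inner T (f i) (f j) = (if i = j then 1 else 0)" for i j
    using e f by (auto simp: orthonormal_basis_def)
  show "(case p of (j, k) \<Rightarrow> tensor (e j) (f k)) \<in> L2 (S \<times> T)" for p
    by (cases p) (simp add: L2_tensor S T eL fL)
  show "L2_inner (S \<times> T) (case p of (j, k) \<Rightarrow> tensor (e j) (f k)) (case q of (j, k) \<Rightarrow> tensor (e j) (f k)) =
      (if p = q then 1 else 0)" for p q
    by (cases p; cases q) (simp add: L2_inner_tensor S T eL fL on)
  show "\<exists>F. finite F \<and> L2_inner (S \<times> T) d d - (\<Sum>p\<in>F. (L2_inner (S \<times> T) d (case p of (j, k) \<Rightarrow> tensor (e j) (f k)))\<^sup>2) < \<epsilon>"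
    if "d \<in> L2 (S \<times> T)" "\<epsilon> > 0" for d \<epsilon>
    using double_suminf_finite_approx[OF _ L2_Parseval_tensor[OF S T that(1) e f] L2.ip_nonneg[OF that(1)] that(2)]
    by (simp add: case_prod_unfold)
qed (simp_all add: L2.approximable_self)

section \<open>Dirichlet eigendata\<close>

lemma dirichlet_eigendata_dense:
  assumes "open \<Omega>" "dirichlet_eigendata \<Omega> lam e"
  shows "test_functions_dense \<Omega>"
proof (rule test_functions_denseI[OF assms(1)])
  show "orthonormal_basis (L2 \<Omega>) (L2_inner \<Omega>) e"
    using assms(2) by (simp add: dirichlet_eigendata_def)
  show "L2.approximable \<Omega> (test_functions \<Omega>) (e j)" for j
    using assms(2) by (intro H01_L2_approximable) (auto simp: dirichlet_eigendata_def dirichlet_eigenpair_def)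
qed

lemma powr_neg_half_squared_mult:
  fixes a :: real
  assumes "a > 0"
  shows "(a powr (- 1 / 2))\<^sup>2 * a = 1"
proof -
  have "(a powr (- 1 / 2))\<^sup>2 = a powr (- 1)"
    by (simp add: power2_eq_square flip: powr_add)
  also have "\<dots> = 1 / a" using assms by (simp add: powr_minus_divide)
  finally show ?thesis using assms by simp
qed

text \<open>
  Parseval's identity in \<open>H\<^sub>0\<^sup>1\<close>, with the gradient products rewritten as \<open>L\<^sup>2\<close> products by the
  eigenvalue equation. The normalising factor contributes \<open>1 / \<lambda>\<close> and the equation \<open>\<lambda>\<^sup>2\<close>.
\<close>
lemma dirichlet_Parseval_grad:
  assumes \<Omega>: "open \<Omega>" and ed: "dirichlet_eigendata \<Omega> lam e" and h: "h \<in> test_functions \<Omega>"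
  shows "(\<Sum>j. ennreal (lam j * (L2_inner \<Omega> h (e j))\<^sup>2)) =
    (\<integral>\<^sup>+x. ennreal ((norm (classical_grad h x))\<^sup>2) \<partial>lebesgue_on \<Omega>)"
proof -
  note dense = dirichlet_eigendata_dense[OF \<Omega> ed]
  interpret G: function_semi_inner "H1 \<Omega>" "grad_inner \<Omega>" by (rule H1_inner_products[OF \<Omega> dense])
  have hH: "h \<in> H01 \<Omega>" using test_functions_H01[OF \<Omega> dense] h by auto
  have b: "orthonormal_basis (H01 \<Omega>) (grad_inner \<Omega>) (\<lambda>j x. lam j powr (- 1 / 2) * e j x)"
    using ed by (simp add: dirichlet_eigendata_def)
  have "(grad_inner \<Omega> h (\<lambda>x. lam j powr (- 1 / 2) * e j x))\<^sup>2 = lam j * (L2_inner \<Omega> h (e j))\<^sup>2" for j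
  proof -
    have lam: "lam j > 0" and ep: "dirichlet_eigenpair \<Omega> (lam j) (e j)"
      using ed by (auto simp: dirichlet_eigendata_def)
    have "grad_inner \<Omega> h (\<lambda>x. lam j powr (- 1 / 2) * e j x) = lam j powr (- 1 / 2) * grad_inner \<Omega> (e j) h"
      using ep hH H01_subset_H1 by (subst G.ip_commute, subst G.ip_scale) (auto simp: dirichlet_eigenpair_def)
    also have "\<dots> = lam j powr (- 1 / 2) * (lam j * L2_inner \<Omega> h (e j))"
      using ep hH by (simp add: dirichlet_eigenpair_def L2.ip_commute)
    finally have "(grad_inner \<Omega> h (\<lambda>x. lam j powr (- 1 / 2) * e j x))\<^sup>2 =
        ((lam j powr (- 1 / 2))\<^sup>2 * lam j) * (lam j * (L2_inner \<Omega> h (e j))\<^sup>2)"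
      by (simp only: power_mult_distrib power2_eq_square mult_ac)
    then show ?thesis by (simp only: powr_neg_half_squared_mult[OF lam] mult_1_left)
  qed
  then have "(\<Sum>j. ennreal (lam j * (L2_inner \<Omega> h (e j))\<^sup>2)) = ennreal (grad_inner \<Omega> h h)"
    using G.Parseval_suminf[OF b H01_subset_H1 hH] by simp
  also have "grad_inner \<Omega> h h = (LINT x|lebesgue_on \<Omega>. (norm (classical_grad h x))\<^sup>2)"
    using has_weak_gradient_classical_grad[OF \<Omega> h]
    by (simp add: grad_inner_eq[OF \<Omega> dense] power2_norm_eq_inner)
  also have "ennreal \<dots> = (\<integral>\<^sup>+x. ennreal ((norm (classical_grad h x))\<^sup>2) \<partial>lebesgue_on \<Omega>)"
    using classical_grad_L2[OF \<Omega> h] by (simp add: L2_def nn_integral_eq_integral)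
  finally show ?thesis .
qed

lemma dirichlet_Parseval_partial_grad:
  fixes S :: "'a::euclidean_space set" and T :: "'b::euclidean_space set"
  assumes S: "open S" and T: "open T" "bounded T"
    and e: "dirichlet_eigendata S lam e" and f: "orthonormal_basis (L2 T) (L2_inner T) f"
    and \<Phi>: "\<Phi> \<in> test_functions (S \<times> T)"
  shows "(\<Sum>j. \<Sum>k. ennreal (lam j * (L2_inner (S \<times> T) \<Phi> (tensor (e j) (f k)))\<^sup>2)) =
    (\<integral>\<^sup>+z. ennreal ((norm (fst (classical_grad \<Phi> z)))\<^sup>2) \<partial>lebesgue_on (S \<times> T))"
proof (rule Parseval_by_slices[OF S T])
  have ST: "open (S \<times> T)" using S T by (auto intro: open_Times)
  show "\<Phi> \<in> L2 (S \<times> T)" by (rule test_functions_L2[OF ST \<Phi>])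
  show "e j \<in> L2 S" "L2_inner S (e j) (e j) = 1" "lam j \<ge> 0" for j
    using e by (auto simp: dirichlet_eigendata_def orthonormal_basis_def less_imp_le)
  show "orthonormal_basis (L2 T) (L2_inner T) f" by fact
  have "(\<lambda>z. fst (classical_grad \<Phi> z)) \<in> borel_measurable (lebesgue_on (S \<times> T))"
    using L2_fst_snd(1)[OF classical_grad_L2[OF ST \<Phi>]] by (simp add: L2_def)
  then show "(\<lambda>z. (norm (fst (classical_grad \<Phi> z)))\<^sup>2) \<in> borel_measurable (lebesgue_on (S \<times> T))"
    by measurable
  show "AE y in lebesgue_on T. (\<Sum>j. ennreal (lam j * (L2_inner S (\<lambda>x. \<Phi> (x, y)) (e j))\<^sup>2)) =
      (\<integral>\<^sup>+x. ennreal ((norm (fst (classical_grad \<Phi> (x, y))))\<^sup>2) \<partial>lebesgue_on S)"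
    using dirichlet_Parseval_grad[OF S e test_functions_section_fst(1)[OF \<Phi>]]
    by (intro AE_I2) (simp add: classical_grad_product[OF \<Phi>])
qed

lemma ennreal_suminf_commute:
  fixes a :: "nat \<Rightarrow> nat \<Rightarrow> ennreal"
  shows "(\<Sum>j. \<Sum>k. a j k) = (\<Sum>k. \<Sum>j. a j k)"
  using nn_integral_suminf[of "\<lambda>j k. a j k" "count_space UNIV"]
  by (simp add: nn_integral_count_space_nat)

text \<open>
  The squared norm of the gradient is the sum of those of its two components. Each component has
  a Parseval identity, weighted by the eigenvalues of its own factor; the one for the second
  component is obtained by exchanging the factors.
\<close>
lemma dirichlet_Parseval_tensor:
  fixes S :: "'a::euclidean_space set" and T :: "'b::euclidean_space set"
  assumes S: "open S" "bounded S" and T: "open T" "bounded T"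
    and e: "dirichlet_eigendata S lam1 e" and f: "dirichlet_eigendata T lam2 f"
    and dense: "test_functions_dense (S \<times> T)" and \<Phi>: "\<Phi> \<in> test_functions (S \<times> T)"
  shows "(\<Sum>j. \<Sum>k. ennreal ((lam1 j + lam2 k) * (L2_inner (S \<times> T) \<Phi> (tensor (e j) (f k)))\<^sup>2)) =
    ennreal (grad_inner (S \<times> T) \<Phi> \<Phi>)"
proof -
  let ?c = "\<lambda>j k. (L2_inner (S \<times> T) \<Phi> (tensor (e j) (f k)))\<^sup>2" and ?g = "classical_grad \<Phi>"
  have ST: "open (S \<times> T)" using S T by (auto intro: open_Times)
  have eb: "orthonormal_basis (L2 S) (L2_inner S) e" and fb: "orthonormal_basis (L2 T) (L2_inner T) f"
    and lam: "lam1 j > 0" "lam2 j > 0" for j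
    using e f by (auto simp: dirichlet_eigendata_def)
  have eL: "e j \<in> L2 S" and fL: "f k \<in> L2 T" for j k using eb fb by (auto simp: orthonormal_basis_def)
  have gL: "?g \<in> L2 (S \<times> T)" by (rule classical_grad_L2[OF ST \<Phi>])
  have gm: "(\<lambda>z. fst (?g z)) \<in> borel_measurable (lebesgue_on (S \<times> T))"
    "(\<lambda>z. snd (?g z)) \<in> borel_measurable (lebesgue_on (S \<times> T))"
    using L2_fst_snd[OF gL] by (auto simp: L2_def)
  have nm: "(\<lambda>z. ennreal ((norm (fst (?g z)))\<^sup>2)) \<in> borel_measurable (lebesgue_on (S \<times> T))"
    "(\<lambda>z. ennreal ((norm (snd (?g z)))\<^sup>2)) \<in> borel_measurable (lebesgue_on (S \<times> T))"
    using measurable_compose[where g="\<lambda>w. ennreal ((norm w)\<^sup>2)", OF gm(1)]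
      measurable_compose[where g="\<lambda>w. ennreal ((norm w)\<^sup>2)", OF gm(2)] by measurable
  have 1: "(\<Sum>j. \<Sum>k. ennreal (lam1 j * ?c j k)) = (\<integral>\<^sup>+z. ennreal ((norm (fst (?g z)))\<^sup>2) \<partial>lebesgue_on (S \<times> T))"
    by (rule dirichlet_Parseval_partial_grad[OF S(1) T e fb \<Phi>])
  let ?P = "\<lambda>z. \<Phi> (prod.swap z)"
  have swap_c: "L2_inner (T \<times> S) ?P (tensor (f k) (e j)) = L2_inner (S \<times> T) \<Phi> (tensor (e j) (f k))" for j k
  proof -
    have "(\<lambda>z. \<Phi> z * tensor (e j) (f k) z) \<in> borel_measurable (lebesgue_on (S \<times> T))"
      by (intro borel_measurable_integrable L2_integrable_mult test_functions_L2 ST \<Phi> L2_tensor S T eL fL)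
    from lebesgue_on_swap(2)[OF T(1) S(1) this] show ?thesis
      by (simp add: L2_inner_def tensor_eq mult_ac)
  qed
  have swap_g: "fst (classical_grad ?P z) = snd (?g (prod.swap z))" for z
    by (cases z) (simp add: classical_grad_product[OF \<Phi>] classical_grad_product[OF test_functions_swap(1)[OF \<Phi>]])
  have "(\<Sum>j. \<Sum>k. ennreal (lam2 k * ?c j k)) = (\<Sum>k. \<Sum>j. ennreal (lam2 k * ?c j k))"
    by (rule ennreal_suminf_commute)
  also have "\<dots> = (\<integral>\<^sup>+z. ennreal ((norm (snd (?g (prod.swap z))))\<^sup>2) \<partial>lebesgue_on (T \<times> S))"
    using dirichlet_Parseval_partial_grad[OF T(1) S f eb test_functions_swap(1)[OF \<Phi>]]
    by (simp add: swap_c swap_g)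
  also have "\<dots> = (\<integral>\<^sup>+z. ennreal ((norm (snd (?g z)))\<^sup>2) \<partial>lebesgue_on (S \<times> T))"
    by (rule nn_integral_lebesgue_on_swap[OF T(1) S(1) nm(2)])
  finally have 2: "(\<Sum>j. \<Sum>k. ennreal (lam2 k * ?c j k)) = (\<integral>\<^sup>+z. ennreal ((norm (snd (?g z)))\<^sup>2) \<partial>lebesgue_on (S \<times> T))" .
  have "(\<Sum>j. \<Sum>k. ennreal ((lam1 j + lam2 k) * ?c j k)) =
      (\<Sum>j. \<Sum>k. ennreal (lam1 j * ?c j k)) + (\<Sum>j. \<Sum>k. ennreal (lam2 k * ?c j k))"
    using lam by (simp add: distrib_right ennreal_plus less_imp_le suminf_add)
  also have "\<dots> = (\<integral>\<^sup>+z. ennreal ((norm (fst (?g z)))\<^sup>2) + ennreal ((norm (snd (?g z)))\<^sup>2) \<partial>lebesgue_on (S \<times> T))"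
    unfolding 1 2 by (rule nn_integral_add[OF nm, symmetric])
  also have "\<dots> = (\<integral>\<^sup>+z. ennreal ((norm (?g z))\<^sup>2) \<partial>lebesgue_on (S \<times> T))"
    by (intro nn_integral_cong) (simp add: norm_prod_def flip: ennreal_plus)
  also have "\<dots> = ennreal (LINT z|lebesgue_on (S \<times> T). (norm (?g z))\<^sup>2)"
    using gL by (simp add: L2_def nn_integral_eq_integral)
  also have "(LINT z|lebesgue_on (S \<times> T). (norm (?g z))\<^sup>2) = grad_inner (S \<times> T) \<Phi> \<Phi>"
    using has_weak_gradient_classical_grad[OF ST \<Phi>]
    by (simp add: grad_inner_eq[OF ST dense] power2_norm_eq_inner)
  finally show ?thesis .
qed

text \<open>
  A tensor of eigenfunctions is an eigenfunction for the sum of the eigenvalues. Tested with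
  \<open>\<Phi>\<close>, each component of the gradient is handled by integrating first over its own factor, where the
  eigenvalue equation is tested with a slice of \<open>\<Phi>\<close>.
\<close>
lemma grad_inner_tensor_test_function:
  fixes S :: "'a::euclidean_space set" and T :: "'b::euclidean_space set"
  assumes S: "open S" and T: "open T"
    and dense: "test_functions_dense S" "test_functions_dense T" "test_functions_dense (S \<times> T)"
    and e: "e \<in> H1 S" "\<And>h. h \<in> test_functions S \<Longrightarrow> grad_inner S e h = a * L2_inner S e h"
    and f: "f \<in> H1 T" "\<And>h. h \<in> test_functions T \<Longrightarrow> grad_inner T f h = b * L2_inner T f h"
    and \<Phi>: "\<Phi> \<in> test_functions (S \<times> T)"
  shows "grad_inner (S \<times> T) (tensor e f) \<Phi> = (a + b) * L2_inner (S \<times> T) (tensor e f) \<Phi>"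
proof -
  have ST: "open (S \<times> T)" using S T by (rule open_Times)
  let ?ge = "weak_grad S e" and ?gf = "weak_grad T f" and ?g = "classical_grad \<Phi>"
  note we = has_weak_gradient_weak_grad[OF e(1)] and wf = has_weak_gradient_weak_grad[OF f(1)]
  have L: "e \<in> L2 S" "f \<in> L2 T" "?ge \<in> L2 S" "?gf \<in> L2 T"
    using e f we wf by (auto simp: has_weak_gradient_def H1_imp_L2)
  have gL: "?g \<in> L2 (S \<times> T)" by (rule classical_grad_L2[OF ST \<Phi>])
  have i1: "integrable (lebesgue_on (S \<times> T)) (\<lambda>z. (f (snd z) *\<^sub>R ?ge (fst z)) \<bullet> fst (?g z))"
    by (intro L2_integrable_inner L2_scaleR_fst S T L L2_fst_snd gL)
  have i2: "integrable (lebesgue_on (S \<times> T)) (\<lambda>z. (e (fst z) *\<^sub>R ?gf (snd z)) \<bullet> snd (?g z))"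
    by (intro L2_integrable_inner L2_scaleR_snd S T L L2_fst_snd gL)
  have i: "integrable (lebesgue_on (S \<times> T)) (\<lambda>z. tensor e f z * \<Phi> z)"
    by (intro L2_integrable_mult L2_tensor S T L test_functions_L2 ST \<Phi>)
  have slice1: "(LINT x|lebesgue_on S. (f y *\<^sub>R ?ge x) \<bullet> fst (?g (x, y))) =
      a * (LINT x|lebesgue_on S. tensor e f (x, y) * \<Phi> (x, y))" for y
  proof -
    note h = test_functions_section_fst(1)[OF \<Phi>, of y]
    have "(LINT x|lebesgue_on S. ?ge x \<bullet> fst (?g (x, y))) = grad_inner S e (\<lambda>x. \<Phi> (x, y))"
      using grad_inner_eq[OF S dense(1) we has_weak_gradient_classical_grad[OF S h]]
      by (simp add: classical_grad_product[OF \<Phi>])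
    then have "f y * (LINT x|lebesgue_on S. ?ge x \<bullet> fst (?g (x, y))) =
        a * (f y * (LINT x|lebesgue_on S. e x * \<Phi> (x, y)))"
      by (simp add: e(2)[OF h] L2_inner_def)
    then show ?thesis
      by (simp add: tensor_eq mult_ac flip: integral_mult_right_zero)
  qed
  have slice2: "(LINT y|lebesgue_on T. (e x *\<^sub>R ?gf y) \<bullet> snd (?g (x, y))) =
      b * (LINT y|lebesgue_on T. tensor e f (x, y) * \<Phi> (x, y))" for x
  proof -
    note h = test_functions_section_snd(1)[OF \<Phi>, of x]
    have "(LINT y|lebesgue_on T. ?gf y \<bullet> snd (?g (x, y))) = grad_inner T f (\<lambda>y. \<Phi> (x, y))"
      using grad_inner_eq[OF T dense(2) wf has_weak_gradient_classical_grad[OF T h]]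
      by (simp add: classical_grad_product[OF \<Phi>])
    then have "e x * (LINT y|lebesgue_on T. ?gf y \<bullet> snd (?g (x, y))) =
        b * (e x * (LINT y|lebesgue_on T. f y * \<Phi> (x, y)))"
      by (simp add: f(2)[OF h] L2_inner_def)
    then show ?thesis
      by (simp add: tensor_eq mult_ac flip: integral_mult_right_zero)
  qed
  have "grad_inner (S \<times> T) (tensor e f) \<Phi> =
      (LINT z|lebesgue_on (S \<times> T). (f (snd z) *\<^sub>R ?ge (fst z)) \<bullet> fst (?g z) +
        (e (fst z) *\<^sub>R ?gf (snd z)) \<bullet> snd (?g z))"
    unfolding grad_inner_eq[OF ST dense(3) has_weak_gradient_tensor[OF S T L(1,2) we wf]
        has_weak_gradient_classical_grad[OF ST \<Phi>]]
    by (simp add: inner_prod_def)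
  also have "\<dots> = (LINT z|lebesgue_on (S \<times> T). (f (snd z) *\<^sub>R ?ge (fst z)) \<bullet> fst (?g z)) +
      (LINT z|lebesgue_on (S \<times> T). (e (fst z) *\<^sub>R ?gf (snd z)) \<bullet> snd (?g z))"
    by (rule Bochner_Integration.integral_add[OF i1 i2])
  also have "(LINT z|lebesgue_on (S \<times> T). (f (snd z) *\<^sub>R ?ge (fst z)) \<bullet> fst (?g z)) =
      a * L2_inner (S \<times> T) (tensor e f) \<Phi>"
    unfolding Fubini_lebesgue_on_swap(3)[OF S T i1] fst_conv snd_conv slice1
      L2_inner_def Fubini_lebesgue_on_swap(3)[OF S T i] by simp
  also have "(LINT z|lebesgue_on (S \<times> T). (e (fst z) *\<^sub>R ?gf (snd z)) \<bullet> snd (?g z)) =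
      b * L2_inner (S \<times> T) (tensor e f) \<Phi>"
    unfolding Fubini_lebesgue_on(3)[OF S T i2] fst_conv snd_conv slice2
      L2_inner_def Fubini_lebesgue_on(3)[OF S T i] by simp
  finally show ?thesis by (simp add: distrib_right)
qed

theorem theorem4p2:
  fixes \<Omega>1 :: "'a::euclidean_space set" and \<Omega>2 :: "'b::euclidean_space set"
    and lam1 lam2 :: "nat \<Rightarrow> real"
    and e1 :: "nat \<Rightarrow> 'a \<Rightarrow> real" and e2 :: "nat \<Rightarrow> 'b \<Rightarrow> real"
    and u ut :: "nat \<times> nat \<Rightarrow> 'a \<times> 'b \<Rightarrow> real"
  assumes "region \<Omega>1" and "B1 \<Omega>1"
    and "region \<Omega>2" and "B1 \<Omega>2"
    and "dirichlet_eigendata \<Omega>1 lam1 e1"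
    and "dirichlet_eigendata \<Omega>2 lam2 e2"
    and "\<And>j k. u (j, k) = tensor (e1 j) (e2 k)"
    and "\<And>j k. ut (j, k) = (\<lambda>z. (lam1 j + lam2 k) powr (- 1 / 2) * u (j, k) z)"
  shows "orthonormal_basis (L2 (\<Omega>1 \<times> \<Omega>2)) (L2_inner (\<Omega>1 \<times> \<Omega>2)) u \<and>
         orthonormal_basis (H01 (\<Omega>1 \<times> \<Omega>2)) (grad_inner (\<Omega>1 \<times> \<Omega>2)) ut"
proof
  have S: "open \<Omega>1" "bounded \<Omega>1" and T: "open \<Omega>2" "bounded \<Omega>2"
    using assms(1-4) by (auto simp: region_def B1_def)
  have ST: "open (\<Omega>1 \<times> \<Omega>2)" using S T by (auto intro: open_Times)
  note ed1 = assms(5) and ed2 = assms(6)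
  have eb: "orthonormal_basis (L2 \<Omega>1) (L2_inner \<Omega>1) e1" and fb: "orthonormal_basis (L2 \<Omega>2) (L2_inner \<Omega>2) e2"
    and lam: "lam1 j > 0" "lam2 j > 0"
    and ep: "dirichlet_eigenpair \<Omega>1 (lam1 j) (e1 j)" "dirichlet_eigenpair \<Omega>2 (lam2 j) (e2 j)" for j
    using ed1 ed2 by (auto simp: dirichlet_eigendata_def)
  have eH: "e1 j \<in> H01 \<Omega>1" and fH: "e2 j \<in> H01 \<Omega>2" for j
    using ep[of j] by (auto simp: dirichlet_eigenpair_def)
  have eH1: "e1 j \<in> H1 \<Omega>1" and fH1: "e2 j \<in> H1 \<Omega>2" for j
    using eH fH H01_subset_H1 by auto
  have u: "u = (\<lambda>(j, k). tensor (e1 j) (e2 k))" using assms(7) by auto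
  show ub: "orthonormal_basis (L2 (\<Omega>1 \<times> \<Omega>2)) (L2_inner (\<Omega>1 \<times> \<Omega>2)) u"
    unfolding u by (rule L2_orthonormal_basis_tensor[OF S(1) T eb fb])
  note dense1 = dirichlet_eigendata_dense[OF S(1) ed1] and dense2 = dirichlet_eigendata_dense[OF T(1) ed2]
  have dense: "test_functions_dense (\<Omega>1 \<times> \<Omega>2)"
  proof (rule test_functions_denseI[OF ST ub])
    show "L2.approximable (\<Omega>1 \<times> \<Omega>2) (test_functions (\<Omega>1 \<times> \<Omega>2)) (u p)" for p
      using L2_approximable_tensor[OF S(1) T(1) H1_imp_L2[OF eH1] H01_L2_approximable[OF eH]
          H1_imp_L2[OF fH1] H01_L2_approximable[OF fH]]
      by (cases p) (simp add: u)
  qed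
  interpret G: function_semi_inner "H1 (\<Omega>1 \<times> \<Omega>2)" "grad_inner (\<Omega>1 \<times> \<Omega>2)"
    by (rule H1_inner_products[OF ST dense])
  have uH: "tensor (e1 j) (e2 k) \<in> H01 (\<Omega>1 \<times> \<Omega>2)" for j k
    by (rule H01_tensor[OF S(1) T(1) dense1 dense2 dense eH fH])
  have uH1: "tensor (e1 j) (e2 k) \<in> H1 (\<Omega>1 \<times> \<Omega>2)" for j k
    using uH H01_subset_H1 by auto
  have ut: "ut (j, k) = (\<lambda>z. (lam1 j + lam2 k) powr (- 1 / 2) * tensor (e1 j) (e2 k) z)" for j k
    using assms(8) by (simp add: u)
  have half: "((lam1 j + lam2 k) powr (- 1 / 2))\<^sup>2 * (lam1 j + lam2 k) = 1" for j k
    using add_pos_pos[OF lam(1)[of j] lam(2)[of k]] by (rule powr_neg_half_squared_mult)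
  show "orthonormal_basis (H01 (\<Omega>1 \<times> \<Omega>2)) (grad_inner (\<Omega>1 \<times> \<Omega>2)) ut"
  proof (rule G.orthonormal_basisI[where D="test_functions (\<Omega>1 \<times> \<Omega>2)"])
    show "ut p \<in> H01 (\<Omega>1 \<times> \<Omega>2)" for p
      by (cases p) (simp add: ut H01_cmult[OF ST dense uH])
    show "grad_inner (\<Omega>1 \<times> \<Omega>2) (ut p) (ut q) = (if p = q then 1 else 0)" for p q
    proof -
      obtain j k l m where pq: "p = (j, k)" "q = (l, m)" by (metis surj_pair)
      let ?s = "\<lambda>j k. (lam1 j + lam2 k) powr (- 1 / 2)"
      have "grad_inner (\<Omega>1 \<times> \<Omega>2) (ut p) (ut q) =
          ?s j k * (?s l m * grad_inner (\<Omega>1 \<times> \<Omega>2) (tensor (e1 j) (e2 k)) (tensor (e1 l) (e2 m)))"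
        unfolding pq ut
        by (simp add: G.ip_scale uH1 G.scale_mem G.ip_commute[of "tensor (e1 j) (e2 k)" "\<lambda>z. c * v z" for c v]
            G.ip_commute[of "tensor (e1 l) (e2 m)" "tensor (e1 j) (e2 k)"])
      also have "grad_inner (\<Omega>1 \<times> \<Omega>2) (tensor (e1 j) (e2 k)) (tensor (e1 l) (e2 m)) =
          (if p = q then lam1 j + lam2 k else 0)"
        using ep eH fH eb fb
        by (simp add: grad_inner_tensor[OF S(1) T(1) dense eH1 eH1 fH1 fH1] pq
            dirichlet_eigenpair_def orthonormal_basis_def)
      finally show ?thesis
        using half[of l m] pq by (auto simp: power2_eq_square mult.assoc)
    qed
    show "\<exists>F. finite F \<and> grad_inner (\<Omega>1 \<times> \<Omega>2) \<Phi> \<Phi> - (\<Sum>p\<in>F. (grad_inner (\<Omega>1 \<times> \<Omega>2) \<Phi> (ut p))\<^sup>2) < \<epsilon>"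
      if \<Phi>: "\<Phi> \<in> test_functions (\<Omega>1 \<times> \<Omega>2)" and "\<epsilon> > 0" for \<Phi> \<epsilon>
    proof -
      have \<Phi>H: "\<Phi> \<in> H1 (\<Omega>1 \<times> \<Omega>2)" using \<Phi> test_functions_H1[OF ST] by auto
      have "(grad_inner (\<Omega>1 \<times> \<Omega>2) \<Phi> (ut (j, k)))\<^sup>2 =
          (lam1 j + lam2 k) * (L2_inner (\<Omega>1 \<times> \<Omega>2) \<Phi> (tensor (e1 j) (e2 k)))\<^sup>2" for j k
      proof -
        have "grad_inner (\<Omega>1 \<times> \<Omega>2) \<Phi> (ut (j, k)) =
            (lam1 j + lam2 k) powr (- 1 / 2) * grad_inner (\<Omega>1 \<times> \<Omega>2) (tensor (e1 j) (e2 k)) \<Phi>"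
          unfolding ut by (subst G.ip_commute) (rule G.ip_scale[OF uH1 \<Phi>H])
        also have "grad_inner (\<Omega>1 \<times> \<Omega>2) (tensor (e1 j) (e2 k)) \<Phi> =
            (lam1 j + lam2 k) * L2_inner (\<Omega>1 \<times> \<Omega>2) \<Phi> (tensor (e1 j) (e2 k))"
          unfolding L2.ip_commute[of _ \<Phi>]
          by (rule grad_inner_tensor_test_function[OF S(1) T(1) dense1 dense2 dense eH1 _ fH1 _ \<Phi>])
             (use ep test_functions_H01[OF S(1) dense1] test_functions_H01[OF T(1) dense2]
               in \<open>auto simp: dirichlet_eigenpair_def\<close>)
        finally show ?thesis
          using half[of j k] by (simp add: power_mult_distrib power2_eq_square mult_ac)
      qed
      then have "(\<Sum>j. \<Sum>k. ennreal ((grad_inner (\<Omega>1 \<times> \<Omega>2) \<Phi> (ut (j, k)))\<^sup>2)) =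
          ennreal (grad_inner (\<Omega>1 \<times> \<Omega>2) \<Phi> \<Phi>)"
        using dirichlet_Parseval_tensor[OF S T ed1 ed2 dense \<Phi>] by simp
      from double_suminf_finite_approx[OF _ this grad_inner_self_nonneg \<open>\<epsilon> > 0\<close>]
      show ?thesis by (simp add: case_prod_unfold)
    qed
    show "G.approximable (test_functions (\<Omega>1 \<times> \<Omega>2)) v" if "v \<in> H01 (\<Omega>1 \<times> \<Omega>2)" for v
      by (rule H01_grad_approximable[OF ST dense that])
  qed (use H01_subset_H1 test_functions_H1[OF ST] in auto)
qed

end
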